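(* (Key formula.) Let $w$ satisfy the standing assumptions ( * ) of the context and fix $x\in(0,x_{\mathrm{cr}}]$. For any $p\ge0$, any integer $t\ge0$ and any positive functional $f$, $$\mathbb E_p\Big[f\big(S|_{[0,t]},\eta|_{[0,t]}\big)\mathbf 1_{\mathcal L_t}\mathbf 1_{S|_{[0,t]}\ge\mathrm K}\Big]=\mathbb E_p^{\mathrm{RW}}\Big[f\big(S|_{[0,t]},\eta|_{[0,t]}\big)\mathbf 1_{\mathcal L_t}\mathbf 1_{S|_{[0,t]}\ge\mathrm K}\cdot\frac{\widetilde W_{S_t}}{\widetilde W_{S_0}}\Big],$$ where on the left $(S,\eta)$ is the decoration-reproduction process of the locally largest exploration under the Boltzmann law $\mathbb P_p=\mathbb P_p^x$, and on the right $(S,\eta)$ has i.i.d. increments given by $\hat\nu$.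
   Context: **Fully parked trees.** A parking tree $\mathbbm t=(\mathrm t,\ell^{\mathrm{car}},\ell^{\mathrm{spot}})$ is a finite rooted plane tree with car arrivals $\ell^{\mathrm{car}}$ on vertices and parking capacities $\ell^{\mathrm{spot}}$ on edges (values in $\mathbb Z_{\ge0}$). Cars drive from their arrival vertex towards the root and park on the edges as soon as possible. $\phi(u)$ is the number of cars exiting $u$ towards the root. The tree is fully parked if no spot is left empty; equivalently, for all $u$ with children $u_1,\dots,u_k$ joined by edges $e_1,\dots,e_k$, $\phi(u_i)\ge\ell^{\mathrm{spot}}(e_i)$ and $\phi(u)=\ell^{\mathrm{car}}(u)+\sum_i(\phi(u_i)-\ell^{\mathrm{spot}}(e_i))$. $\mathrm{FPT}^n_p$: fully parked trees with $n$ vertices and root flux $p$. **Weights.** A local weight function is a family of reals $w_{c,k,(s_1,\dots,s_k)}\ge0$; $\mathrm w(\mathbbm t)=\prod_{u}w_{\ell^{\mathrm{car}}(u),k_u,(\ell^{\mathrm{spot}}(e_i(u)))_{i\le k_u}}$ ($k_u$ number of children of $u$, $e_i(u)$ edges above $u$ from left to right); $W_p^x=\sum_{n\ge1}\sum_{\mathbbm t\in\mathrm{FPT}^n_p}x^n\mathrm w(\mathbbm t)$; $F(x,y)=\sum_pW_p^xy^p$. One has $W_i^x=x\sum w_{c,k,(s_1,\dots,s_k)}\sum_{p_j\ge s_j,\ \sum_j(p_j-s_j)+c=i}\prod_jW^x_{p_j}$. Dependency graph: on $\mathbb Z_{\ge0}$, $i\to j$ iff a monomial involving $W_j$ appears with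 non-zero coefficient on the right of the equation for $W_i^x$. **Standing assumptions ( * )**: (1) there is an integer $\mathrm K\ge0$ with $w_{c,k,(s_1,\dots,s_k)}=0$ if $k>\mathrm K$, $c>\mathrm K$ or some $s_i>\mathrm K$; (2) $w$ is symmetric in $(s_1,\dots,s_k)$; (3) $w_{c,k,(s_1,\dots,s_k)}>0$ for some $k\ge2$ and some $c,s_i$; (4) there is $p\ge0$ such that any $q,r\ge p$ are joined in both directions by oriented paths of the dependency graph staying in $\{p,p+1,\dots\}$; (5) $0$ is connected by an oriented path to some $p\ge1$, and $W_p^x>0$ for all $p\ge0,x>0$; (6) $x\mapsto W_0^x$ has a unique dominant singularity on the boundary of its disk of convergence. **Boltzmann law.** $x_{\mathrm{cr}}\in(0,\infty)$ is the common radius of convergence of the $x\mapsto W_p^x$ (and $W_p^{x_{\mathrm{cr}}}<\infty$). For fixed $x\in(0,x_{\mathrm{cr}}]$ (dropped from notation), $y_{\mathrm{cr}}\in(0,\infty)$ is the radius of convergence of $y\mapsto F(x,y)$, $\widetilde W_p=y_{\mathrm{cr}}^pW_p^x$, and $\mathbb P_p$ is the law of $\mathbf t=(\mathrm t,\phi)$ when $\mathbbm t\in\bigcup_n\mathrm{FPT}^n_p$ has probability $x^{\#\mathrm t}\mathrm w(\mathbbm t)/W_p^x$. **Locally largest exploration.** $\varnothing=u_0,u_1,\dots,u_\tau$: $u_{i+1}$ is the child of $u_i$ with the largest label (left-most in case of ties), $u_\tau$ the first leaf reached. $S_i=\phi(u_i)$, $0\le i\le\tau$; $Y^i_1,Y^i_2,\dots$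 are the labels of the siblings of $u_i$ from left to right; $\eta=\sum_{i\ge1}\sum_{j\ge1}\delta_{(i,Y^i_j)}$. $S|_{[0,t]}=(S_i)_{0\le i\le t}$, $\eta|_{[0,t]}$ is the restriction to $[0,t]\times\mathbb Z_{\ge0}$. Under $\mathbb P_p$, the indicators are $0$ if $t>\tau$. **Measure $\hat\nu$.** For $q\in\mathbb Z$, $c\ge0$, $0\le k\le\mathrm K-1$, $s_0,\dots,s_k,p_1,\dots,p_k\ge0$, $$\hat\nu(q;c,(s_0,\dots,s_k),(p_1,\dots,p_k))=x\,y_{\mathrm{cr}}^{-q}(k+1)\,w_{c,k+1,(s_0,\dots,s_k)}\prod_{i=1}^kW_{p_i}^x$$ if $\sum_{i=1}^kp_i-\sum_{i=0}^ks_i+c=-q$ and $p_i\ge s_i$ for $1\le i\le k$, and $0$ otherwise. It is a probability measure. $\mathbb P_p^{\mathrm{RW}}$: with $(X_i,(Y^i_j)_{j\ge1})_{i\ge1}$ i.i.d. distributed as $(q,(p_1,\dots,p_k))$ under $\hat\nu$, set $S_0=p$, $S_n=p+\sum_{i=1}^nX_i$, $\eta=\sum_{i,j}\delta_{(i,Y^i_j)}$. **Event $\mathcal L_t$**: $S_i>Y^i_j$ for all $j\ge1$ and all $1\le i\le t$. *)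

theory Defs
  imports "HOL-Probability.Probability"
begin

section \<open>Fully parked trees\<close>

text \<open>
  A node carries its car arrivals and the left-to-right list of its children; the edge to a child
  is represented by its capacity, paired with the subtree hanging there. A tree is identified with
  its root, so vertices are represented by the subtrees above them.
\<close>
datatype ptree = Node (cars: nat) (branches: "(nat \<times> ptree) list")

fun num_vertices :: "ptree \<Rightarrow> nat" where
  "num_vertices (Node c bs) = 1 + (\<Sum>b\<leftarrow>bs. num_vertices (snd b))"

text \<open>
  The truncated subtraction is the parking rule: of the \<open>flux t\<close> cars entering an edge with \<open>s\<close>
  spots, \<open>min s (flux t)\<close> park there and the others drive on.
\<close>
fun flux :: "ptree \<Rightarrow> nat" where
  "flux (Node c bs) = c + (\<Sum>b\<leftarrow>bs. flux (snd b) - fst b)"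

fun fully_parked :: "ptree \<Rightarrow> bool" where
  "fully_parked (Node c bs) \<longleftrightarrow> (\<forall>b\<in>set bs. fst b \<le> flux (snd b) \<and> fully_parked (snd b))"

definition FPT :: "nat \<Rightarrow> nat \<Rightarrow> ptree set" where
  "FPT n p = {t. num_vertices t = n \<and> fully_parked t \<and> flux t = p}"


section \<open>Weights and partition functions\<close>

text \<open>
  The number \<open>w c s\<close> is the local weight of a vertex with \<open>c\<close> cars and \<open>length s\<close> children whose
  edges have capacities \<open>s\<close>; the number of children is not a separate argument.
\<close>
type_synonym local_weight = "nat \<Rightarrow> nat list \<Rightarrow> real"

fun tree_weight :: "local_weight \<Rightarrow> ptree \<Rightarrow> real" where
  "tree_weight w (Node c bs) = w c (map fst bs) * (\<Prod>b\<leftarrow>bs. tree_weight w (snd b))"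

definition fpt_coeff :: "local_weight \<Rightarrow> nat \<Rightarrow> nat \<Rightarrow> ennreal" where
  "fpt_coeff w p n = (\<integral>\<^sup>+ t. ennreal (tree_weight w t) \<partial>count_space (FPT n p))"

text \<open>
  Partition functions take values in \<open>[0, \<infinity>]\<close>, because positivity is required below
  for all \<open>x > 0\<close>, also where the series diverges. There is no term for \<open>n = 0\<close>
  as \<open>FPT 0 p\<close> is empty.
\<close>
definition W :: "local_weight \<Rightarrow> real \<Rightarrow> nat \<Rightarrow> ennreal" where
  "W w x p = (\<Sum>n. ennreal (x ^ n) * fpt_coeff w p n)"

text \<open>
  Under the standing assumptions below, all the series \<open>W w x p\<close> have the same radius of
  convergence in \<open>x\<close>, so that \<open>p = 0\<close> may be used to define it.
\<close>
definition x_cr :: "local_weight \<Rightarrow> ereal" where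
  "x_cr w = conv_radius (\<lambda>n. enn2real (fpt_coeff w 0 n))"

definition y_cr :: "local_weight \<Rightarrow> real \<Rightarrow> real" where
  "y_cr w x = real_of_ereal (conv_radius (\<lambda>p. enn2real (W w x p)))"

definition W_tilde :: "local_weight \<Rightarrow> real \<Rightarrow> nat \<Rightarrow> real" where
  "W_tilde w x p = y_cr w x ^ p * enn2real (W w x p)"


section \<open>Standing assumptions\<close>

text \<open>
  The right-hand side of the equation for \<open>W w x i\<close> is the sum of \<open>x * w c s * (\<Prod>p\<leftarrow>ps. W w x p)\<close>
  over \<open>c\<close>, \<open>s\<close> and \<open>ps\<close> as below. All its coefficients are non-negative, so there is no
  cancellation and a monomial occurs as soon as one of its contributions is positive.
\<close>
definition dep_edge :: "local_weight \<Rightarrow> nat \<Rightarrow> nat \<Rightarrow> bool" where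
  "dep_edge w i j \<longleftrightarrow>
     (\<exists>c s ps. w c s > 0 \<and> list_all2 (\<le>) s ps \<and>
        (\<Sum>(a, p)\<leftarrow>zip s ps. p - a) + c = i \<and> j \<in> set ps)"

text \<open>
  A point of the circle of convergence is singular if the sum of the power series does not extend
  holomorphically to a neighbourhood of it.
\<close>
definition dominant_singularity :: "(nat \<Rightarrow> complex) \<Rightarrow> complex \<Rightarrow> bool" where
  "dominant_singularity a z \<longleftrightarrow> ereal (norm z) = conv_radius a \<and>
     \<not> (\<exists>r>0. \<exists>g. g holomorphic_on ball z r \<and>
           (\<forall>v\<in>ball z r. ereal (norm v) < conv_radius a \<longrightarrow> g v = (\<Sum>n. a n * v ^ n)))"

definition standing_assumptions :: "local_weight \<Rightarrow> nat \<Rightarrow> bool" where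
  "standing_assumptions w K \<longleftrightarrow>
     (\<forall>c s. w c s \<ge> 0) \<and>
     (\<forall>c s. length s > K \<or> c > K \<or> (\<exists>a\<in>set s. a > K) \<longrightarrow> w c s = 0) \<and>
     (\<forall>c s s'. mset s = mset s' \<longrightarrow> w c s = w c s') \<and>
     (\<exists>c s. length s \<ge> 2 \<and> w c s > 0) \<and>
     (\<exists>p. \<forall>q\<ge>p. \<forall>r\<ge>p. (\<lambda>i j. i \<ge> p \<and> j \<ge> p \<and> dep_edge w i j)\<^sup>*\<^sup>* q r) \<and>
     (\<exists>p\<ge>1. (dep_edge w)\<^sup>*\<^sup>* 0 p) \<and>
     (\<forall>p. \<forall>x>0. W w x p > 0) \<and>
     (\<exists>!z. dominant_singularity (\<lambda>n. complex_of_real (enn2real (fpt_coeff w 0 n))) z)"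


section \<open>Boltzmann law and locally largest exploration\<close>

text \<open>
  This is the law of the parking tree itself; the exploration only depends on its plane tree and on
  the labels \<open>flux\<close>.
\<close>
definition boltzmann :: "local_weight \<Rightarrow> real \<Rightarrow> nat \<Rightarrow> ptree measure" where
  "boltzmann w x p = density (count_space (\<Union>n. FPT n p))
     (\<lambda>t. ennreal (x ^ num_vertices t * tree_weight w t) / W w x p)"

definition child_labels :: "ptree \<Rightarrow> nat list" where
  "child_labels t = map (\<lambda>b. flux (snd b)) (branches t)"

definition ll_index :: "ptree \<Rightarrow> nat" where
  "ll_index t = (LEAST i. i < length (child_labels t) \<and>
                   child_labels t ! i = Max (set (child_labels t)))"

definition ll_child :: "ptree \<Rightarrow> ptree" where
  "ll_child t = snd (branches t ! ll_index t)"

text \<open>The vertex \<open>ll_vertex t i\<close> is meaningful only for \<open>i \<le> ll_time t\<close>.\<close>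
definition ll_vertex :: "ptree \<Rightarrow> nat \<Rightarrow> ptree" where
  "ll_vertex t i = (ll_child ^^ i) t"

definition ll_time :: "ptree \<Rightarrow> nat" where
  "ll_time t = (LEAST i. branches (ll_vertex t i) = [])"

definition tree_S :: "ptree \<Rightarrow> nat \<Rightarrow> int" where
  "tree_S t i = int (flux (ll_vertex t i))"

text \<open>For \<open>i \<ge> 1\<close>, the labels of the siblings of \<open>ll_vertex t i\<close> from left to right.\<close>
definition tree_Y :: "ptree \<Rightarrow> nat \<Rightarrow> nat list" where
  "tree_Y t i = (let u = ll_vertex t (i - 1)
                 in take (ll_index u) (child_labels u) @ drop (Suc (ll_index u)) (child_labels u))"


section \<open>Functionals of the decoration and reproduction processes\<close>

definition restr_S :: "nat \<Rightarrow> (nat \<Rightarrow> int) \<Rightarrow> int list" where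
  "restr_S t S = map S [0..<Suc t]"

text \<open>The finite point measure \<open>\<Sum>\<^sub>i\<^sub>\<le>\<^sub>t \<Sum>\<^sub>j \<delta>\<^bsub>(i, Y i j)\<^esub>\<close> is encoded as the multiset of its atoms.\<close>
definition restr_eta :: "nat \<Rightarrow> (nat \<Rightarrow> nat list) \<Rightarrow> (nat \<times> nat) multiset" where
  "restr_eta t Y = (\<Sum>i\<in>{1..t}. image_mset (Pair i) (mset (Y i)))"

definition event_L :: "nat \<Rightarrow> (nat \<Rightarrow> int) \<Rightarrow> (nat \<Rightarrow> nat list) \<Rightarrow> bool" where
  "event_L t S Y \<longleftrightarrow> (\<forall>i\<in>{1..t}. \<forall>y\<in>set (Y i). S i > int y)"

definition event_ge :: "nat \<Rightarrow> nat \<Rightarrow> (nat \<Rightarrow> int) \<Rightarrow> bool" where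
  "event_ge K t S \<longleftrightarrow> (\<forall>i\<in>{0..t}. S i \<ge> int K)"


section \<open>The random walk\<close>

text \<open>A step \<open>(q, c, (s\<^sub>0, \<dots>, s\<^sub>k), (p\<^sub>1, \<dots>, p\<^sub>k))\<close>.\<close>
type_synonym step = "int \<times> nat \<times> nat list \<times> nat list"

text \<open>In the second line, \<open>length ps < K\<close> is the constraint \<open>k \<le> K - 1\<close>.\<close>
definition nu_hat :: "local_weight \<Rightarrow> nat \<Rightarrow> real \<Rightarrow> step \<Rightarrow> real" where
  "nu_hat w K x = (\<lambda>(q, c, s, ps).
     if length s = Suc (length ps) \<and> length ps < K \<and>
        int (sum_list ps) - int (sum_list s) + int c = - q \<and> list_all2 (\<le>) (tl s) ps
     then x * y_cr w x powi (- q) * real (Suc (length ps)) * w c s *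
          (\<Prod>p\<leftarrow>ps. enn2real (W w x p))
     else 0)"

definition nu_hat_measure :: "local_weight \<Rightarrow> nat \<Rightarrow> real \<Rightarrow> step measure" where
  "nu_hat_measure w K x = density (count_space UNIV) (\<lambda>z. ennreal (nu_hat w K x z))"

text \<open>
  The joint law of the first \<open>t\<close> steps of the walk with i.i.d. steps of law \<open>nu_hat_measure w K x\<close>,
  which has total mass 1 under the standing assumptions. The functionals considered here do not
  depend on the steps after time \<open>t\<close>.
\<close>
definition rw_law :: "local_weight \<Rightarrow> nat \<Rightarrow> real \<Rightarrow> nat \<Rightarrow> (nat \<Rightarrow> step) measure" where
  "rw_law w K x t = PiM {1..t} (\<lambda>_. nu_hat_measure w K x)"

definition rw_S :: "nat \<Rightarrow> (nat \<Rightarrow> step) \<Rightarrow> nat \<Rightarrow> int" where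
  "rw_S p \<omega> n = int p + (\<Sum>i\<in>{1..n}. fst (\<omega> i))"

definition rw_Y :: "(nat \<Rightarrow> step) \<Rightarrow> nat \<Rightarrow> nat list" where
  "rw_Y \<omega> i = snd (snd (snd (\<omega> i)))"

end

theory Submission
  imports Defs
begin

text \<open>
  Decompose a tree at its root. If the largest label among the children of the root is strictly
  larger than the others, the symmetry of the weights allows to move the corresponding child to the
  front, at the price of a factor \<open>k + 1\<close>; summing over the trees grafted on its siblings produces
  \<open>\<Prod>i. W w x p\<^sub>i\<close>, hence the weight \<open>nu_hat\<close> up to a power of \<open>y_cr\<close>, and these powers telescope
  along the exploration. The restriction \<open>S \<ge> K\<close> makes the explored child fill its edge.

  The identity needs \<open>0 < y_cr < \<infinity>\<close> and the finiteness of the partition functions, also at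
  \<open>x = x_cr\<close>. Both come from lower bounds in the equation for \<open>W\<close>: the edges of the dependency
  graph make \<open>W w x j\<close> at most a multiple of \<open>W w x i\<close>, with constants which are uniform in \<open>x\<close>, and
  a vertex with two children makes \<open>(W w x q)\<^sup>2\<close> at most a multiple of \<open>W w x q\<close>. So \<open>W w x q\<close> is bounded
  for \<open>x < x_cr\<close>, hence finite at \<open>x_cr\<close>. This leaves out the labels \<open>j\<close> below all capacities
  of the vertices with several children, but these labels are smaller than \<open>K\<close> and never occur
  among siblings.
\<close>

section \<open>Sums over discrete spaces\<close>

lemma nn_integral_count_space_swap:
  "(\<integral>\<^sup>+a. \<integral>\<^sup>+b. f a b \<partial>count_space UNIV \<partial>count_space UNIV) =
   (\<integral>\<^sup>+b. \<integral>\<^sup>+a. f a b \<partial>count_space UNIV \<partial>count_space UNIV)"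
  using nn_integral_fst_count_space[of "case_prod f"] nn_integral_snd_count_space[of "case_prod f"]
  by simp

lemma nn_integral_count_space_delta:
  "(\<integral>\<^sup>+a. (if c = a then f a else 0) \<partial>count_space UNIV) = f c"
proof -
  have "(\<integral>\<^sup>+a. (if c = a then f a else 0) \<partial>count_space UNIV) =
        (\<integral>\<^sup>+a. f a * indicator {c} a \<partial>count_space UNIV)"
    by (intro nn_integral_cong) (auto simp: indicator_def)
  then show ?thesis by simp
qed

lemma nn_integral_if:
  "(\<integral>\<^sup>+z. (if Q then F z else 0) \<partial>M) = (if Q then \<integral>\<^sup>+z. F z \<partial>M else 0)"
  by (cases Q) simp_all

lemma nn_integral_count_space_fibre:
  "(\<integral>\<^sup>+b. G (h b) b \<partial>count_space UNIV) =
   (\<integral>\<^sup>+a. \<integral>\<^sup>+b. (if h b = a then G a b else 0) \<partial>count_space UNIV \<partial>count_space UNIV)"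
  by (subst nn_integral_count_space_swap) (simp add: nn_integral_count_space_delta)

lemma nn_integral_count_space_Sigma:
  "(\<integral>\<^sup>+z. f z \<partial>count_space UNIV) =
   (\<integral>\<^sup>+a. \<integral>\<^sup>+b. f (a, b) \<partial>count_space UNIV \<partial>count_space UNIV)"
  by (rule nn_integral_fst_count_space[symmetric])

lemma nn_integral_count_space_inj:
  assumes "inj_on g A" "\<And>y. y \<notin> g ` A \<Longrightarrow> f y = 0"
  shows "(\<integral>\<^sup>+y. f y \<partial>count_space UNIV) =
    (\<integral>\<^sup>+a. (if a \<in> A then f (g a) else 0) \<partial>count_space UNIV)"
proof -
  have "(\<integral>\<^sup>+y. f y \<partial>count_space UNIV) = (\<integral>\<^sup>+y. f y \<partial>count_space (g ` A))"
    by (subst (2) nn_integral_count_space_indicator)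
      (auto intro!: nn_integral_cong simp: assms(2) indicator_def)
  also have "\<dots> = (\<integral>\<^sup>+a. f (g a) \<partial>count_space A)"
    by (rule nn_integral_bij_count_space[symmetric]) (simp add: assms(1) bij_betw_def)
  also have "\<dots> = (\<integral>\<^sup>+a. (if a \<in> A then f (g a) else 0) \<partial>count_space UNIV)"
    by (subst nn_integral_count_space_indicator) (auto intro!: nn_integral_cong)
  finally show ?thesis .
qed

lemma nn_integral_count_space_list:
  "(\<integral>\<^sup>+l. f l \<partial>count_space UNIV) =
   f [] + (\<integral>\<^sup>+b. \<integral>\<^sup>+l. f (b # l) \<partial>count_space UNIV \<partial>count_space UNIV)"
proof -
  have "(\<integral>\<^sup>+l. f l \<partial>count_space UNIV) =
      (\<integral>\<^sup>+l. (if [] = l then f l else 0) + (if l = [] then 0 else f l) \<partial>count_space UNIV)"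
    by (intro nn_integral_cong) auto
  also have "\<dots> = f [] + (\<integral>\<^sup>+l. (if l = [] then 0 else f l) \<partial>count_space UNIV)"
    by (subst nn_integral_add) (auto simp only: nn_integral_count_space_delta measurable_count_space space_borel, auto)
  also have "(\<integral>\<^sup>+l. (if l = [] then 0 else f l) \<partial>count_space UNIV) =
     (\<integral>\<^sup>+z. f (fst z # snd z) \<partial>count_space UNIV)"
    by (subst nn_integral_count_space_inj[of "\<lambda>z. fst z # snd z" UNIV])
       (auto simp: inj_on_def image_iff neq_Nil_conv)
  also have "\<dots> = (\<integral>\<^sup>+b. \<integral>\<^sup>+l. f (b # l) \<partial>count_space UNIV \<partial>count_space UNIV)"
    by (subst nn_integral_count_space_Sigma) simp
  finally show ?thesis .
qed

lemma nn_integral_count_space_image: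
  assumes "\<And>a. M a = (\<integral>\<^sup>+b. (if h b = a then m b else 0) \<partial>count_space UNIV)"
  shows "(\<integral>\<^sup>+b. g (h b) * m b \<partial>count_space UNIV) = (\<integral>\<^sup>+a. g a * M a \<partial>count_space UNIV)"
proof -
  have "(\<integral>\<^sup>+b. g (h b) * m b \<partial>count_space UNIV) =
    (\<integral>\<^sup>+a. \<integral>\<^sup>+b. g a * (if h b = a then m b else 0) \<partial>count_space UNIV \<partial>count_space UNIV)"
    by (subst nn_integral_count_space_fibre[where h = h]) (auto intro!: nn_integral_cong)
  then show ?thesis by (simp add: nn_integral_cmult assms)
qed

lemma nn_integral_count_space_by_length:
  "(\<integral>\<^sup>+l. f l \<partial>count_space UNIV) =
   (\<integral>\<^sup>+n. \<integral>\<^sup>+l. (if length l = n then f l else 0) \<partial>count_space UNIV \<partial>count_space UNIV)"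
  using nn_integral_count_space_fibre[of "\<lambda>_. f" length] .

lemma nn_integral_count_space_image_list:
  assumes M: "\<And>a. M a = (\<integral>\<^sup>+b. (if h b = a then m b else 0) \<partial>count_space UNIV)"
  shows "(\<integral>\<^sup>+l. G (map h l) * (\<Prod>b\<leftarrow>l. m b) \<partial>count_space UNIV) =
         (\<integral>\<^sup>+l. G l * (\<Prod>a\<leftarrow>l. M a) \<partial>count_space UNIV)"
proof -
  have "(\<integral>\<^sup>+l. (if length l = n then G (map h l) * (\<Prod>b\<leftarrow>l. m b) else 0) \<partial>count_space UNIV) =
         (\<integral>\<^sup>+l. (if length l = n then G l * (\<Prod>a\<leftarrow>l. M a) else 0) \<partial>count_space UNIV)" for n
  proof (induction n arbitrary: G)
    case 0
    show ?case by (simp add: nn_integral_count_space_list)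
  next
    case (Suc n)
    have "(\<integral>\<^sup>+l. (if length l = Suc n then G (map h l) * (\<Prod>b\<leftarrow>l. m b) else 0) \<partial>count_space UNIV) =
       (\<integral>\<^sup>+b. \<integral>\<^sup>+l. m b * (if length l = n then G (h b # map h l) * (\<Prod>b\<leftarrow>l. m b) else 0)
         \<partial>count_space UNIV \<partial>count_space UNIV)"
      by (subst nn_integral_count_space_list) (auto intro!: nn_integral_cong simp: mult_ac)
    also have "\<dots> = (\<integral>\<^sup>+b. (\<integral>\<^sup>+l. (if length l = n then G (h b # l) * (\<Prod>a\<leftarrow>l. M a) else 0)
         \<partial>count_space UNIV) * m b \<partial>count_space UNIV)"
      by (simp add: nn_integral_cmult Suc.IH[of "\<lambda>l. G (h _ # l)"] mult_ac)
    also have "\<dots> = (\<integral>\<^sup>+a. (\<integral>\<^sup>+l. (if length l = n then G (a # l) * (\<Prod>a\<leftarrow>l. M a) else 0)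
         \<partial>count_space UNIV) * M a \<partial>count_space UNIV)"
      by (rule nn_integral_count_space_image[OF M])
    also have "\<dots> = (\<integral>\<^sup>+a. \<integral>\<^sup>+l. M a * (if length l = n then G (a # l) * (\<Prod>a\<leftarrow>l. M a) else 0)
         \<partial>count_space UNIV \<partial>count_space UNIV)"
      by (simp add: nn_integral_cmult mult_ac)
    also have "\<dots> = (\<integral>\<^sup>+l. (if length l = Suc n then G l * (\<Prod>a\<leftarrow>l. M a) else 0) \<partial>count_space UNIV)"
      by (subst nn_integral_count_space_list[of "\<lambda>l. if length l = Suc n then _ l else 0"])
        (auto intro!: nn_integral_cong simp: mult_ac)
    finally show ?case .
  qed
  then show ?thesis
    by (subst (1 2) nn_integral_count_space_by_length) simp
qed

section \<open>Inserting a strict maximum\<close>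

definition insert_at :: "nat \<Rightarrow> 'a \<Rightarrow> 'a list \<Rightarrow> 'a list" where
  "insert_at i b r = take i r @ b # drop i r"

lemma map_insert_at: "map g (insert_at i b r) = insert_at i (g b) (map g r)"
  by (simp add: insert_at_def take_map drop_map)

lemma set_insert_at: "set (insert_at i b r) = insert b (set r)"
  using set_append[of "take i r" "drop i r"] by (auto simp: insert_at_def)

lemma mset_insert_at: "mset (insert_at i b r) = add_mset b (mset r)"
proof -
  have "mset r = mset (take i r) + mset (drop i r)"
    by (simp only: mset_append[symmetric] append_take_drop_id)
  then show ?thesis by (simp add: insert_at_def)
qed

lemma sum_list_insert_at: "sum_list (insert_at i b r) = (b :: nat) + sum_list r"
  by (simp only: sum_mset_sum_list[symmetric] mset_insert_at sum_mset.add_mset)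

lemma prod_list_insert_at: "prod_list (insert_at i b r) = (b :: ennreal) * prod_list r"
  by (simp only: prod_mset_prod_list[symmetric] mset_insert_at prod_mset.add_mset)

lemma insert_at_nth: "i < length l \<Longrightarrow> insert_at i (l ! i) (take i l @ drop (Suc i) l) = l"
  by (simp add: insert_at_def id_take_nth_drop[symmetric])

lemma insert_at_strict_max_unique:
  assumes "i \<le> length r" "j \<le> length r'" "\<forall>y\<in>set r. v y < (v b :: nat)" "\<forall>y\<in>set r'. v y < v b'"
    and eq: "insert_at i b r = insert_at j b' r'"
  shows "i = j \<and> b = b' \<and> r = r'"
proof -
  note eq = eq[unfolded insert_at_def]
  have "b \<in> set (take j r' @ b' # drop j r')" "b' \<in> set (take i r @ b # drop i r)"
    by (metis eq in_set_conv_decomp)+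
  then have "v b \<le> v b'" "v b' \<le> v b" using assms(3,4)
    by (auto dest!: in_set_takeD in_set_dropD intro: less_imp_le)
  then have vv: "v b = v b'" by simp
  have "b \<notin> set (take j r')" "b' \<notin> set (take i r)"
    using vv assms(3,4) by (auto dest!: in_set_takeD)
  moreover have "b' \<notin> set (drop i r)" "b \<notin> set (drop j r')"
    using vv assms(3,4) by (auto dest!: in_set_dropD)
  moreover have "b' = b" using \<open>b \<in> set (take j r' @ b' # drop j r')\<close> calculation by auto
  ultimately have "take i r = take j r'" "drop i r = drop j r'" "b = b'"
    using eq by (auto simp: append_Cons_eq_iff)
  then show ?thesis using assms(1,2)
    by (metis append_take_drop_id length_take min.absorb2)
qed

lemma nn_integral_strict_max:
  fixes v :: "'a \<Rightarrow> nat"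
  assumes zero: "\<And>l. \<nexists>i b r. i \<le> length r \<and> (\<forall>y\<in>set r. v y < v b) \<and> l = insert_at i b r
     \<Longrightarrow> F l = 0"
    and F: "\<And>i b r. i \<le> length r \<Longrightarrow> \<forall>y\<in>set r. v y < v b \<Longrightarrow> F (insert_at i b r) = F' b r"
  shows "(\<integral>\<^sup>+l. F l \<partial>count_space UNIV) = (\<integral>\<^sup>+b. \<integral>\<^sup>+r.
     (if \<forall>y\<in>set r. v y < v b then of_nat (Suc (length r)) * F' b r else 0)
     \<partial>count_space UNIV \<partial>count_space UNIV)"
proof -
  define A where "A = {(b, r, i). i \<le> length r \<and> (\<forall>y\<in>set r. v y < v b)}"
  have "(\<integral>\<^sup>+l. F l \<partial>count_space UNIV) =
     (\<integral>\<^sup>+z. (if z \<in> A then F ((\<lambda>(b, r, i). insert_at i b r) z) else 0) \<partial>count_space UNIV)"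
  proof (rule nn_integral_count_space_inj)
    show "inj_on (\<lambda>(b, r, i). insert_at i b r) A"
      by (rule inj_onI) (use insert_at_strict_max_unique[where v = v] in \<open>force simp: A_def\<close>)
    show "F l = 0" if "l \<notin> (\<lambda>(b, r, i). insert_at i b r) ` A" for l
      by (rule zero) (use that in \<open>force simp: A_def\<close>)
  qed
  also have "\<dots> = (\<integral>\<^sup>+b. \<integral>\<^sup>+r. \<integral>\<^sup>+i. (if (b, r, i) \<in> A then F (insert_at i b r) else 0)
       \<partial>count_space UNIV \<partial>count_space UNIV \<partial>count_space UNIV)"
    by (auto simp add: nn_integral_count_space_Sigma intro!: nn_integral_cong)
  also have "\<dots> = (\<integral>\<^sup>+b. \<integral>\<^sup>+r.
     (if \<forall>y\<in>set r. v y < v b then of_nat (Suc (length r)) * F' b r else 0)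
     \<partial>count_space UNIV \<partial>count_space UNIV)"
  proof (intro nn_integral_cong)
    fix b r
    have "(\<integral>\<^sup>+i. (if (b, r, i) \<in> A then F (insert_at i b r) else 0) \<partial>count_space UNIV)
       = (\<integral>\<^sup>+i. (if \<forall>y\<in>set r. v y < v b then F' b r else 0) * indicator {..length r} i \<partial>count_space UNIV)"
      by (intro nn_integral_cong) (auto simp: A_def F indicator_def)
    also have "\<dots> = (if \<forall>y\<in>set r. v y < v b then of_nat (Suc (length r)) * F' b r else 0)"
      by (subst nn_integral_cmult_indicator) (auto simp: mult_ac)
    finally show "(\<integral>\<^sup>+i. (if (b, r, i) \<in> A then F (insert_at i b r) else 0) \<partial>count_space UNIV)
       = (if \<forall>y\<in>set r. v y < v b then of_nat (Suc (length r)) * F' b r else 0)" .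
  qed
  finally show ?thesis .
qed

section \<open>Partition functions\<close>

definition tree_mass :: "local_weight \<Rightarrow> real \<Rightarrow> ptree \<Rightarrow> ennreal" where
  "tree_mass w x T = (if fully_parked T then ennreal (x ^ num_vertices T * tree_weight w T) else 0)"

lemma tree_weight_nonneg:
  assumes "\<And>c s. w c s \<ge> 0"
  shows "tree_weight w T \<ge> 0"
  using assms
proof (induction w T rule: tree_weight.induct)
  case (1 w' c bs)
  then have "0 \<le> (\<Prod>b\<leftarrow>bs. tree_weight w' (snd b))"
    by (intro prod_list_nonneg) auto
  then show ?case using 1 by simp
qed

lemma nn_integral_ptree:
  "(\<integral>\<^sup>+T. F T \<partial>count_space UNIV) =
   (\<integral>\<^sup>+c. \<integral>\<^sup>+bs. F (Node c bs) \<partial>count_space UNIV \<partial>count_space UNIV)"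
proof -
  have "(\<integral>\<^sup>+T. F T \<partial>count_space UNIV) =
    (\<integral>\<^sup>+z. (if z \<in> UNIV then F ((\<lambda>(c, bs). Node c bs) z) else 0) \<partial>count_space UNIV)"
  proof (rule nn_integral_count_space_inj)
    show "F T = 0" if "T \<notin> range (\<lambda>(c, bs). Node c bs)" for T
      using that by (cases T) auto
  qed (auto simp: inj_on_def)
  then show ?thesis by (simp add: nn_integral_count_space_Sigma)
qed

lemma W_eq_nn_integral:
  assumes "\<And>c s. w c s \<ge> 0" "x \<ge> 0"
  shows "W w x p = (\<integral>\<^sup>+T. (if flux T = p then tree_mass w x T else 0) \<partial>count_space UNIV)"
proof -
  have "W w x p = (\<integral>\<^sup>+n. ennreal (x ^ n) * (\<integral>\<^sup>+T. ennreal (tree_weight w T) * indicator (FPT n p) T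
      \<partial>count_space UNIV) \<partial>count_space UNIV)"
    by (simp add: W_def fpt_coeff_def nn_integral_count_space_nat nn_integral_count_space_indicator)
  also have "\<dots> = (\<integral>\<^sup>+n. \<integral>\<^sup>+T. (if num_vertices T = n
      then (if flux T = p then tree_mass w x T else 0) else 0) \<partial>count_space UNIV \<partial>count_space UNIV)"
    using assms by (subst nn_integral_cmult[symmetric])
      (auto intro!: nn_integral_cong simp: FPT_def tree_mass_def indicator_def ennreal_mult tree_weight_nonneg)
  also have "\<dots> = (\<integral>\<^sup>+T. (if flux T = p then tree_mass w x T else 0) \<partial>count_space UNIV)"
    by (rule nn_integral_count_space_fibre[symmetric])
  finally show ?thesis .
qed

lemma prod_tree_mass:
  assumes "\<And>c s. w c s \<ge> 0" "x \<ge> 0"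
  shows "(\<Prod>b\<leftarrow>bs. tree_mass w x (snd b)) = (if \<forall>b\<in>set bs. fully_parked (snd b)
     then ennreal (x ^ (\<Sum>b\<leftarrow>bs. num_vertices (snd b)) * (\<Prod>b\<leftarrow>bs. tree_weight w (snd b))) else 0)"
proof (induction bs)
  case (Cons b bs)
  have "0 \<le> (\<Prod>b\<leftarrow>bs. tree_weight w (snd b))"
    by (rule prod_list_nonneg) (auto intro: tree_weight_nonneg assms)
  with Cons show ?case
    using assms by (auto simp: tree_mass_def power_add ennreal_mult'[symmetric] tree_weight_nonneg mult_ac)
qed simp

lemma tree_mass_Node:
  assumes "\<And>c s. w c s \<ge> 0" "x \<ge> 0"
  shows "tree_mass w x (Node c bs) = (if \<forall>b\<in>set bs. fst b \<le> flux (snd b)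
     then ennreal (x * w c (map fst bs)) * (\<Prod>b\<leftarrow>bs. tree_mass w x (snd b)) else 0)"
proof -
  have "0 \<le> (\<Prod>b\<leftarrow>bs. tree_weight w (snd b))"
    by (rule prod_list_nonneg) (auto intro: tree_weight_nonneg assms)
  then show ?thesis
    unfolding prod_tree_mass[OF assms]
    using assms by (auto simp: tree_mass_def power_add ennreal_mult'[symmetric] mult_ac)
qed

lemma nn_integral_branches:
  fixes G :: "(nat \<times> nat) list \<Rightarrow> ennreal"
  assumes "\<And>c s. w c s \<ge> 0" "x \<ge> 0"
  shows "(\<integral>\<^sup>+bs. G (map (map_prod id flux) bs) * (\<Prod>b\<leftarrow>bs. tree_mass w x (snd b)) \<partial>count_space UNIV) =
     (\<integral>\<^sup>+sp. G sp * (\<Prod>b\<leftarrow>sp. W w x (snd b)) \<partial>count_space UNIV)"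
proof (rule nn_integral_count_space_image_list[where m = "\<lambda>b. tree_mass w x (snd b)"
      and M = "\<lambda>b. W w x (snd b)"])
  fix a :: "nat \<times> nat"
  have "(\<integral>\<^sup>+ b. (if map_prod id flux b = a then tree_mass w x (snd b) else 0) \<partial>count_space UNIV)
    = (\<integral>\<^sup>+ s. \<integral>\<^sup>+ T. (if fst a = s then (if flux T = snd a then tree_mass w x T else 0) else 0)
      \<partial>count_space UNIV \<partial>count_space UNIV)"
    by (cases a) (subst nn_integral_count_space_Sigma, auto intro!: nn_integral_cong)
  also have "\<dots> = (\<integral>\<^sup>+ s. (if fst a = s then W w x (snd a) else 0) \<partial>count_space UNIV)"
    by (auto intro!: nn_integral_cong simp: W_eq_nn_integral[OF assms])
  finally show "W w x (snd a) =
      (\<integral>\<^sup>+ b. (if map_prod id flux b = a then tree_mass w x (snd b) else 0) \<partial>count_space UNIV)"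
    by (simp add: nn_integral_count_space_delta)
qed

lemma W_recursion:
  assumes "\<And>c s. w c s \<ge> 0" "x \<ge> 0"
  shows "W w x i = (\<integral>\<^sup>+c. \<integral>\<^sup>+sp.
     (if (\<forall>b\<in>set sp. fst b \<le> snd b) \<and> c + (\<Sum>b\<leftarrow>sp. snd b - fst b) = i
      then ennreal (x * w c (map fst sp)) else 0) * (\<Prod>b\<leftarrow>sp. W w x (snd b))
     \<partial>count_space UNIV \<partial>count_space UNIV)"
proof -
  have "W w x i = (\<integral>\<^sup>+c. \<integral>\<^sup>+bs.
     (if (\<forall>b\<in>set (map (map_prod id flux) bs). fst b \<le> snd b) \<and>
          c + (\<Sum>b\<leftarrow>map (map_prod id flux) bs. snd b - fst b) = i
      then ennreal (x * w c (map fst (map (map_prod id flux) bs))) else 0) *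
       (\<Prod>b\<leftarrow>bs. tree_mass w x (snd b))
     \<partial>count_space UNIV \<partial>count_space UNIV)"
    unfolding W_eq_nn_integral[OF assms]
    by (subst nn_integral_ptree) (auto intro!: nn_integral_cong simp: tree_mass_Node[OF assms] comp_def)
  then show ?thesis
    by (simp only: nn_integral_branches[OF assms, where G = "\<lambda>sp.
      (if (\<forall>b\<in>set sp. fst b \<le> snd b) \<and> _ + (\<Sum>b\<leftarrow>sp. snd b - fst b) = i
        then ennreal (x * w _ (map fst sp)) else 0)"])
qed

lemma W_ge_node:
  assumes "\<And>c s. w c s \<ge> 0" "x \<ge> 0" "list_all2 (\<le>) s ps"
  shows "ennreal (x * w c s) * (\<Prod>p\<leftarrow>ps. W w x p) \<le> W w x (c + (\<Sum>(a, p)\<leftarrow>zip s ps. p - a))"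
proof -
  let ?i = "c + (\<Sum>(a, p)\<leftarrow>zip s ps. p - a)"
  define G where "G c sp =
     (if (\<forall>b\<in>set sp. fst b \<le> snd b) \<and> c + (\<Sum>b\<leftarrow>sp. snd b - fst b) = ?i
      then ennreal (x * w c (map fst sp)) else 0) * (\<Prod>b\<leftarrow>sp. W w x (snd b))" for c sp
  have len: "length s = length ps" using assms(3) by (rule list_all2_lengthD)
  have "ennreal (x * w c s) * (\<Prod>p\<leftarrow>ps. W w x p) = G c (zip s ps)"
  proof -
    have "(\<Prod>b\<leftarrow>zip s ps. W w x (snd b)) = (\<Prod>p\<leftarrow>map snd (zip s ps). W w x p)"
      by (simp only: map_map comp_def)
    then show ?thesis using assms(3) len
      by (auto simp: G_def list_all2_iff case_prod_unfold)
  qed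
  also have "\<dots> \<le> (\<integral>\<^sup>+sp. G c sp \<partial>count_space UNIV)"
    by (rule nn_integral_ge_point) simp
  also have "\<dots> \<le> (\<integral>\<^sup>+c. \<integral>\<^sup>+sp. G c sp \<partial>count_space UNIV \<partial>count_space UNIV)"
    by (rule nn_integral_ge_point[of c _ "\<lambda>c. \<integral>\<^sup>+sp. G c sp \<partial>count_space UNIV"]) simp
  also have "\<dots> = W w x ?i" by (simp add: W_recursion[OF assms(1,2), where i = ?i] G_def)
  finally show ?thesis .
qed

lemma W_mono:
  assumes "0 \<le> x" "x \<le> y"
  shows "W w x p \<le> W w y p"
  unfolding W_def using assms by (intro suminf_le mult_right_mono ennreal_leI power_mono) auto

section \<open>Finiteness of the partition functions\<close>

lemma standing_nonneg: "standing_assumptions w K \<Longrightarrow> 0 \<le> w c s"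
  unfolding standing_assumptions_def by blast

lemma standing_bounded:
  assumes "standing_assumptions w K" "w c s \<noteq> 0"
  shows "length s \<le> K" "c \<le> K" "set s \<subseteq> {..K}"
proof -
  have *: "length s > K \<or> c > K \<or> (\<exists>a\<in>set s. a > K) \<longrightarrow> w c s = 0"
    using assms(1) unfolding standing_assumptions_def by blast
  show "length s \<le> K" "c \<le> K" "set s \<subseteq> {..K}"
    using * assms(2) by (auto simp: not_less[symmetric] subset_iff)
qed

lemma standing_symmetric:
  "standing_assumptions w K \<Longrightarrow> mset s = mset s' \<Longrightarrow> w c s = w c s'"
  unfolding standing_assumptions_def by blast

lemma standing_W_pos: "standing_assumptions w K \<Longrightarrow> 0 < x \<Longrightarrow> 0 < W w x p"
  unfolding standing_assumptions_def by blast

lemma standing_branching: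
  assumes "standing_assumptions w K"
  obtains c s where "length s \<ge> 2" "w c s > 0"
  using assms unfolding standing_assumptions_def by blast

lemma finite_weighted_trees:
  assumes "standing_assumptions w K"
  shows "finite {T. num_vertices T \<le> n \<and> tree_weight w T \<noteq> 0}"
proof (induction n)
  case 0
  have "\<not> num_vertices T \<le> 0" for T by (cases T) simp
  then have "{T. num_vertices T \<le> 0 \<and> tree_weight w T \<noteq> 0} = {}" by blast
  then show ?case by (simp only: finite.emptyI)
next
  case (Suc n)
  let ?A = "{T. num_vertices T \<le> n \<and> tree_weight w T \<noteq> 0}"
  have "{T. num_vertices T \<le> Suc n \<and> tree_weight w T \<noteq> 0} \<subseteq>
     (\<lambda>(c, bs). Node c bs) ` ({..K} \<times> {bs. set bs \<subseteq> {..K} \<times> ?A \<and> length bs \<le> K})"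
  proof
    fix T assume T: "T \<in> {T. num_vertices T \<le> Suc n \<and> tree_weight w T \<noteq> 0}"
    obtain c bs where [simp]: "T = Node c bs" by (cases T)
    have w: "w c (map fst bs) \<noteq> 0" using T by simp
    have "num_vertices (snd b) \<le> n" "tree_weight w (snd b) \<noteq> 0" "fst b \<le> K"
      if "b \<in> set bs" for b
    proof -
      have "num_vertices (snd b) \<le> (\<Sum>b\<leftarrow>bs. num_vertices (snd b))"
        by (rule member_le_sum_list) (use that in auto)
      then show "num_vertices (snd b) \<le> n" using T by simp
      show "tree_weight w (snd b) \<noteq> 0"
        using T that by (force simp: prod_list_zero_iff)
      show "fst b \<le> K" using standing_bounded(3)[OF assms w] that by auto
    qed
    then have "b \<in> {..K} \<times> ?A" if "b \<in> set bs" for b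
      using that by (cases b) force
    then have "set bs \<subseteq> {..K} \<times> ?A" by blast
    then have "(c, bs) \<in> {..K} \<times> {bs. set bs \<subseteq> {..K} \<times> ?A \<and> length bs \<le> K}"
      using standing_bounded(1,2)[OF assms w] by simp
    then show "T \<in> (\<lambda>(c, bs). Node c bs) ` ({..K} \<times> {bs. set bs \<subseteq> {..K} \<times> ?A \<and> length bs \<le> K})"
      by (rule rev_image_eqI) simp
  qed
  moreover have "finite ({..K} \<times> {bs. set bs \<subseteq> {..K} \<times> ?A \<and> length bs \<le> K})"
    by (intro finite_cartesian_product finite_lists_length_le) (use Suc in auto)
  ultimately show ?case by (meson finite_imageI finite_subset)
qed

lemma fpt_coeff_finite:
  assumes "standing_assumptions w K"
  shows "fpt_coeff w p n < \<infinity>"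
proof -
  have "finite {T \<in> FPT n p. 0 < ennreal (tree_weight w T)}"
    by (rule finite_subset[OF _ finite_weighted_trees[OF assms, of n]]) (auto simp: FPT_def)
  then show ?thesis
    unfolding fpt_coeff_def by (subst nn_integral_count_space) auto
qed

lemma W_eq_suminf:
  assumes "standing_assumptions w K" "0 \<le> x"
  shows "W w x p = (\<Sum>n. ennreal (x ^ n * enn2real (fpt_coeff w p n)))"
  unfolding W_def using fpt_coeff_finite[OF assms(1), of p] assms(2)
  by (auto intro!: suminf_cong simp: ennreal_mult)

lemma W_0_finite:
  assumes "standing_assumptions w K" "0 \<le> x" "ereal x < x_cr w"
  shows "W w x 0 < \<infinity>"
proof -
  have "summable (\<lambda>n. enn2real (fpt_coeff w 0 n) * x ^ n)"
    by (rule summable_in_conv_radius) (use assms in \<open>simp add: x_cr_def\<close>)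
  then have "(\<Sum>n. ennreal (x ^ n * enn2real (fpt_coeff w 0 n))) \<noteq> \<infinity>"
    using assms(2) by (subst suminf_ennreal2) (auto simp: mult.commute)
  then show ?thesis by (simp add: W_eq_suminf[OF assms(1,2)] top.not_eq_extremum)
qed

lemma W_le_of_less:
  assumes "standing_assumptions w K" "0 < x" "\<And>y. 0 < y \<Longrightarrow> y < x \<Longrightarrow> W w y p \<le> B"
  shows "W w x p \<le> B"
proof -
  define P where "P N y = (\<Sum>n<N. y ^ n * enn2real (fpt_coeff w p n))" for N and y :: real
  have P: "(\<Sum>n<N. ennreal (y ^ n * enn2real (fpt_coeff w p n))) = ennreal (P N y)"
    if "0 \<le> y" for N y unfolding P_def using that by (intro sum_ennreal) auto
  have "ennreal (P N x) \<le> B" for N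
  proof (rule tendsto_upperbound)
    have "(P N \<longlongrightarrow> P N x) (at_left x)"
      unfolding P_def by (intro tendsto_intros)
    then show "((\<lambda>y. ennreal (P N y)) \<longlongrightarrow> ennreal (P N x)) (at_left x)"
      by (rule tendsto_ennrealI)
    show "\<forall>\<^sub>F y in at_left x. ennreal (P N y) \<le> B"
      using eventually_at_left_real[OF assms(2)]
    proof eventually_elim
      case (elim y)
      then have "ennreal (P N y) = (\<Sum>n<N. ennreal (y ^ n * enn2real (fpt_coeff w p n)))"
        using P[of y N] elim by simp
      also have "\<dots> \<le> (\<Sum>n. ennreal (y ^ n * enn2real (fpt_coeff w p n)))"
        by (rule sum_le_suminf) auto
      also have "\<dots> = W w y p"
        using elim by (intro W_eq_suminf[OF assms(1), symmetric]) simp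
      finally have "ennreal (P N y) \<le> W w y p" .
      then show ?case using assms(3)[of y] elim by auto
    qed
  qed simp
  then have "(\<Sum>n<N. ennreal (x ^ n * enn2real (fpt_coeff w p n))) \<le> B" for N
    using P[of x N] assms(2) by simp
  then have "(\<Sum>n. ennreal (x ^ n * enn2real (fpt_coeff w p n))) \<le> B"
    by (intro suminf_le_const) auto
  then show ?thesis using W_eq_suminf[OF assms(1)] assms(2) by simp
qed

lemma prod_list_W_pos:
  assumes "standing_assumptions w K" "0 < x"
  shows "0 < (\<Prod>p\<leftarrow>ps. W w x p)"
  by (induction ps) (auto simp: ennreal_zero_less_mult_iff standing_W_pos[OF assms])

lemma prod_list_W_mono:
  assumes "0 \<le> x" "x \<le> y"
  shows "(\<Prod>p\<leftarrow>ps. W w x p) \<le> (\<Prod>p\<leftarrow>ps. W w y p)"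
  by (induction ps) (auto intro!: mult_mono W_mono assms)

lemma W_ge_child:
  assumes "standing_assumptions w K" "0 \<le> x" "x \<le> y" "a \<le> j" "list_all2 (\<le>) s ps"
  shows "ennreal (x * w c (a # s)) * (\<Prod>p\<leftarrow>ps. W w x p) * W w y j
    \<le> W w y (c + (j - a) + (\<Sum>(a, p)\<leftarrow>zip s ps. p - a))"
proof -
  have "ennreal (x * w c (a # s)) * (\<Prod>p\<leftarrow>ps. W w x p) * W w y j
     \<le> ennreal (y * w c (a # s)) * (\<Prod>p\<leftarrow>ps. W w y p) * W w y j"
    using assms by (intro mult_mono ennreal_leI prod_list_W_mono) (auto intro: standing_nonneg)
  also have "\<dots> = ennreal (y * w c (a # s)) * (\<Prod>p\<leftarrow>j # ps. W w y p)"
    by (simp add: mult_ac)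
  also have "\<dots> \<le> W w y (c + (\<Sum>(a, p)\<leftarrow>zip (a # s) (j # ps). p - a))"
    using assms by (intro W_ge_node) (auto intro: standing_nonneg)
  finally show ?thesis by (simp add: add_ac)
qed

lemma sum_list_zip_diff_self [simp]: "(\<Sum>(a, p)\<leftarrow>zip s s. p - a) = (0 :: nat)"
  by (induction s) auto

lemma sum_list_zip_diff_eq_0:
  "list_all2 (\<le>) s ps \<Longrightarrow> (\<Sum>(a, p)\<leftarrow>zip s ps. p - a) = (0 :: nat) \<Longrightarrow> s = ps"
proof (induction rule: list_all2_induct)
  case (Cons a s p ps)
  then have "p - a + (\<Sum>(a, p)\<leftarrow>zip s ps. p - a) = 0" by (simp only: zip_Cons_Cons list.map sum_list.Cons prod.case)
  then have "p \<le> a" "(\<Sum>(a, p)\<leftarrow>zip s ps. p - a) = 0"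
    by (simp_all only: add_is_0 diff_is_0_eq)
  then show ?case using Cons.IH Cons.hyps(1) by (metis le_antisym)
qed simp

lemma standing_growth:
  assumes "standing_assumptions w K"
  obtains a s where "a \<ge> 1" "w 0 (a # s) > 0"
proof -
  obtain p where p: "p \<ge> 1" "(dep_edge w)\<^sup>*\<^sup>* 0 p"
    using assms unfolding standing_assumptions_def by blast
  from p(2) have "p = 0 \<or> (\<exists>j\<ge>1. dep_edge w 0 j)"
    by (induction rule: rtranclp_induct) (auto simp: Suc_le_eq)
  then obtain j where j: "j \<ge> 1" "dep_edge w 0 j" using p(1) by auto
  then obtain s ps where s: "w 0 s > 0" "list_all2 (\<le>) s ps" "(\<Sum>(a, p)\<leftarrow>zip s ps. p - a) = 0" "j \<in> set ps"
    by (auto simp: dep_edge_def simp del: sum_list_eq_0_iff)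
  then have "j \<in> set s" using sum_list_zip_diff_eq_0 by blast
  then have "w 0 (j # remove1 j s) > 0"
    using s(1) standing_symmetric[OF assms, of s "j # remove1 j s" 0] by simp
  then show thesis using that j(1) by blast
qed

lemma W_growth:
  assumes "standing_assumptions w K" "0 < x"
  obtains a C where "a \<ge> 1" "C > 0" "\<And>y i. x \<le> y \<Longrightarrow> C * W w y (i + a) \<le> W w y i"
proof -
  obtain a s where a: "a \<ge> 1" "w 0 (a # s) > 0" using standing_growth[OF assms(1)] .
  show thesis
  proof
    show "a \<ge> 1" by fact
    show "0 < ennreal (x * w 0 (a # s)) * (\<Prod>p\<leftarrow>s. W w x p)"
      using a assms by (auto simp: ennreal_zero_less_mult_iff prod_list_W_pos)
    show "ennreal (x * w 0 (a # s)) * (\<Prod>p\<leftarrow>s. W w x p) * W w y (i + a) \<le> W w y i"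
      if "x \<le> y" for y i
      using W_ge_child[of w K x y a "i + a" s s 0] assms that by (simp add: list_all2_refl)
  qed
qed

lemma W_growth_iterated:
  assumes "\<And>i. C * W w y (i + a) \<le> W w y i"
  shows "C ^ n * W w y (i + n * a) \<le> W w y i"
proof (induction n)
  case (Suc n)
  have "i + Suc n * a = (i + n * a) + a" by simp
  then have "C ^ Suc n * W w y (i + Suc n * a) = C ^ n * (C * W w y ((i + n * a) + a))"
    by (simp only: power_Suc2 mult.assoc)
  also have "\<dots> \<le> C ^ n * W w y (i + n * a)" by (intro mult_left_mono assms) auto
  finally show ?case using Suc by (rule order_trans)
qed simp

lemma ennreal_zero_less_power: "0 < (C :: ennreal) \<Longrightarrow> 0 < C ^ n"
  by (induction n) (auto simp: ennreal_zero_less_mult_iff)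

lemma W_ge_W:
  assumes sa: "standing_assumptions w K" and x: "0 < x"
    and w: "w c (a # b # s) > 0" and j: "a \<le> j"
  obtains C where "C > 0" "\<And>y. x \<le> y \<Longrightarrow> C * W w y j \<le> W w y i"
proof -
  obtain g C where g: "g \<ge> 1" "C > 0" "\<And>y i. x \<le> y \<Longrightarrow> C * W w y (i + g) \<le> W w y i"
    using W_growth[OF sa x] by blast
  define n where "n = c + j"
  have n: "n \<le> i + n * g" using g(1) by (cases g) auto
  define ps where "ps = (b + (i + n * g - c - (j - a))) # s"
  define D where "D = ennreal (x * w c (a # b # s)) * (\<Prod>p\<leftarrow>ps. W w x p)"
  have D: "D * W w y j \<le> W w y (i + n * g)" if "x \<le> y" for y
  proof -
    have "c + (j - a) + (\<Sum>(a, p)\<leftarrow>zip (b # s) ps. p - a) = i + n * g"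
      using n j by (simp add: ps_def n_def)
    then show ?thesis
      using W_ge_child[of w K x y a j "b # s" ps c] x that j sa
      by (simp add: D_def) (simp add: ps_def list_all2_refl)
  qed
  show thesis
  proof
    show "C ^ n * D > 0"
      using g(2) w x by (auto simp: D_def ennreal_zero_less_mult_iff ennreal_zero_less_power
        prod_list_W_pos[OF sa])
    fix y assume y: "x \<le> y"
    have "C ^ n * D * W w y j = C ^ n * (D * W w y j)" by (simp add: mult_ac)
    also have "\<dots> \<le> C ^ n * W w y (i + n * g)" by (intro mult_left_mono D y) auto
    also have "\<dots> \<le> W w y i" by (intro W_growth_iterated g(3) y)
    finally show "C ^ n * D * W w y j \<le> W w y i" .
  qed
qed

lemma ennreal_pos_less_top_factor:
  assumes "C * A \<le> (B :: ennreal)" "C > 0" "B < \<infinity>"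
  shows "A < \<infinity>"
proof (rule ccontr)
  assume "\<not> A < \<infinity>"
  then have "A = \<top>" using top.not_eq_extremum[of A] by auto
  moreover have "C \<noteq> 0" using assms(2) by auto
  ultimately have "C * A = \<top>" by (simp add: ennreal_mult_top)
  then show False using assms(1,3) by (simp add: top_unique)
qed

lemma ennreal_pos_real_le:
  assumes "(C :: ennreal) > 0"
  obtains d where "0 < d" "d \<le> 1" "ennreal d \<le> C"
proof (cases C)
  case (real r)
  show ?thesis
  proof (rule that)
    show "0 < min r 1" using real assms by simp
    show "ennreal (min r 1) \<le> C" unfolding real(2) by (intro ennreal_leI) simp
  qed simp
next
  case top
  show ?thesis by (rule that[of 1]) (simp_all add: top)
qed

lemma W_finite:
  assumes sa: "standing_assumptions w K" and x: "0 < x" "ereal x \<le> x_cr w"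
    and w: "w c s > 0" "length s \<ge> 2" and j: "a \<in> set s" "a \<le> j"
  shows "W w x j < \<infinity>"
proof -
  have "length (remove1 a s) \<noteq> 0" using w(2) j(1) by (simp add: length_remove1)
  then obtain b s' where s': "remove1 a s = b # s'" by (cases "remove1 a s") simp_all
  have w': "w c (a # b # s') > 0"
    using w(1) standing_symmetric[OF sa, of s "a # b # s'" c] j(1) s'
    by (metis insert_DiffM mset.simps(2) mset_remove1 set_mset_mset)
  define q where "q = 2 * a + b"
  define i where "i = c + (q - a) + (q - b)"
  have ai: "a \<le> i" "a \<le> q" by (auto simp: i_def q_def)
  define x0 where "x0 = x / 2"
  have x0: "0 < x0" "x0 < x" using x by (auto simp: x0_def)
  obtain C1 where C1: "C1 > 0" "\<And>y. x0 \<le> y \<Longrightarrow> C1 * W w y i \<le> W w y q"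
    using W_ge_W[OF sa x0(1) w' ai(1)] by blast
  obtain C0 where C0: "C0 > 0" "\<And>y. x0 \<le> y \<Longrightarrow> C0 * W w y q \<le> W w y 0"
    using W_ge_W[OF sa x0(1) w' ai(2)] by blast
  obtain C where C: "C > 0" "\<And>y. x \<le> y \<Longrightarrow> C * W w y j \<le> W w y q"
    using W_ge_W[OF sa x(1) w' j(2)] by blast
  define D where "D = ennreal (x0 * w c (a # b # s')) * (\<Prod>p\<leftarrow>s'. W w x0 p)"
  have "C1 * D > 0"
    using C1 w' x0 by (auto simp: D_def ennreal_zero_less_mult_iff prod_list_W_pos[OF sa])
  then obtain d where d: "0 < d" "d \<le> 1" "ennreal d \<le> C1 * D"
    by (rule ennreal_pos_real_le)
  have bound: "W w y q \<le> ennreal (1 / d)" if y: "x0 \<le> y" "y < x" for y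
  proof -
    have "ereal y < x_cr w" by (rule less_le_trans[OF _ x(2)]) (use y in simp)
    then have "W w y 0 < \<infinity>" using y(1) x0 by (intro W_0_finite[OF sa]) simp_all
    then have "W w y q < \<infinity>" by (rule ennreal_pos_less_top_factor[OF C0(2)[OF y(1)] C0(1)])
    moreover have "0 < W w y q" using standing_W_pos[OF sa] y x0 by auto
    ultimately obtain r where r: "W w y q = ennreal r" "r > 0"
      by (metis ennreal_less_zero_iff infinity_ennreal_def less_top_ennreal)
    have DW: "D * W w y q * W w y q \<le> W w y i"
    proof -
      have "D * W w y q * W w y q \<le>
         ennreal (x0 * w c (a # b # s')) * (\<Prod>p\<leftarrow>q # s'. W w y p) * W w y q"
      proof (rule mult_right_mono)
        have "D * W w y q \<le> ennreal (x0 * w c (a # b # s')) * (\<Prod>p\<leftarrow>s'. W w y p) * W w y q"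
          unfolding D_def using x0 y by (intro mult_right_mono mult_left_mono prod_list_W_mono) simp_all
        then show "D * W w y q \<le> ennreal (x0 * w c (a # b # s')) * (\<Prod>p\<leftarrow>q # s'. W w y p)"
          by (simp add: mult_ac)
      qed simp
      also have "\<dots> \<le> ennreal (y * w c (a # b # s')) * (\<Prod>p\<leftarrow>q # s'. W w y p) * W w y q"
        using standing_nonneg[OF sa] y by (intro mult_right_mono ennreal_leI) auto
      also have "\<dots> \<le> W w y (c + (q - a) + (\<Sum>(a, p)\<leftarrow>zip (b # s') (q # s'). p - a))"
        using x0 y by (intro W_ge_child[OF sa]) (auto simp: q_def list_all2_refl)
      finally show ?thesis by (simp add: i_def)
    qed
    have "C1 * D * W w y q * W w y q \<le> W w y q"
    proof -
      have "C1 * D * W w y q * W w y q = C1 * (D * W w y q * W w y q)" by (simp add: mult_ac)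
      also have "\<dots> \<le> C1 * W w y i" by (intro mult_left_mono DW) simp
      also have "\<dots> \<le> W w y q" by (rule C1(2)[OF y(1)])
      finally show ?thesis .
    qed
    moreover have "ennreal d * W w y q * W w y q \<le> C1 * D * W w y q * W w y q"
      by (intro mult_right_mono d) auto
    ultimately have "ennreal d * W w y q * W w y q \<le> W w y q" by (rule order_trans[rotated])
    then have "d * r * r \<le> r" using r d by (simp add: ennreal_mult'[symmetric])
    then have "r \<le> 1 / d" using r d by (simp add: field_simps)
    then show ?thesis by (simp add: r ennreal_leI)
  qed
  have "W w x q \<le> ennreal (1 / d)"
  proof (rule W_le_of_less[OF sa x(1)])
    fix y assume "0 < y" "y < x"
    then have "W w y q \<le> W w (max y x0) q" by (intro W_mono) auto
    also have "\<dots> \<le> ennreal (1 / d)" using \<open>y < x\<close> x0 by (intro bound) auto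
    finally show "W w y q \<le> ennreal (1 / d)" .
  qed
  then have "W w x q < \<infinity>" by (rule le_less_trans) simp
  then show ?thesis by (rule ennreal_pos_less_top_factor[OF C(2)[OF order_refl] C(1)])
qed

lemma W_finite_ge:
  assumes "standing_assumptions w K" "0 < x" "ereal x \<le> x_cr w" "K \<le> j"
  shows "W w x j < \<infinity>"
proof -
  obtain c s where s: "length s \<ge> 2" "w c s > 0" using standing_branching[OF assms(1)] .
  then obtain a where a: "a \<in> set s" by (cases s) auto
  then have "a \<le> j" using standing_bounded(3)[OF assms(1), of c s] s assms(4) by auto
  then show ?thesis using W_finite[OF assms(1-3) s(2,1) a] by simp
qed

section \<open>The radius of convergence in \<open>y\<close>\<close>

lemma y_cr_pos:
  assumes sa: "standing_assumptions w K" and x: "0 < x" "ereal x \<le> x_cr w"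
  shows "0 < y_cr w x"
proof -
  define f where "f m = enn2real (W w x (m + K))" for m
  have W: "W w x (m + K) = ennreal (f m)" for m
    using W_finite_ge[OF sa x, of "m + K"] by (simp add: f_def)
  have f: "f m > 0" for m
    using standing_W_pos[OF sa x(1), of "m + K"] by (simp add: W)
  let ?R = "conv_radius (\<lambda>p. enn2real (W w x p))"
  have R: "?R = conv_radius f"
    unfolding f_def by (rule conv_radius_shift[symmetric])
  have "0 < ?R"
  proof -
    obtain a C where a: "a \<ge> 1" "C > 0" "\<And>y i. x \<le> y \<Longrightarrow> C * W w y (i + a) \<le> W w y i"
      using W_growth[OF sa x(1)] by blast
    from a(2) obtain d where d: "0 < d" "d \<le> 1" "ennreal d \<le> C" by (rule ennreal_pos_real_le)
    have step: "d * f (m + a) \<le> f m" for m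
    proof -
      have "ennreal d * W w x ((m + K) + a) \<le> C * W w x ((m + K) + a)"
        by (intro mult_right_mono d) auto
      also have "\<dots> \<le> W w x (m + K)" by (rule a(3)) simp
      also have "m + K + a = (m + a) + K" by simp
      finally show ?thesis
        using d f[of m] by (simp only: W) (simp add: ennreal_mult'[symmetric])
    qed
    have iter: "d ^ n * f (m + n * a) \<le> f m" for m n
    proof (induction n)
      case (Suc n)
      have "m + Suc n * a = (m + n * a) + a" by simp
      then have "d ^ Suc n * f (m + Suc n * a) = d ^ n * (d * f ((m + n * a) + a))"
        by (simp only: power_Suc2 mult.assoc)
      also have "\<dots> \<le> d ^ n * f (m + n * a)" by (intro mult_left_mono step) (use d in auto)
      finally show ?case using Suc by simp
    qed simp
    define M where "M = (\<Sum>r<a. f r)"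
    have fM: "d ^ m * f m \<le> M" for m
    proof -
      have "d ^ m * f m \<le> d ^ (m div a) * f m"
        using d f[of m] by (intro mult_right_mono power_decreasing) auto
      also have "\<dots> = d ^ (m div a) * f (m mod a + (m div a) * a)" by (simp add: add.commute)
      also have "\<dots> \<le> f (m mod a)" by (rule iter)
      also have "\<dots> \<le> M" unfolding M_def
        by (rule member_le_sum) (use f a(1) in \<open>auto intro: less_imp_le\<close>)
      finally show ?thesis .
    qed
    have "summable (\<lambda>m. f m * (d / 2) ^ m)"
    proof (rule summable_comparison_test'[where N = 0])
      show "summable (\<lambda>m. M * (1 / 2) ^ m)" by (intro summable_mult summable_geometric) simp
      show "norm (f m * (d / 2) ^ m) \<le> M * (1 / 2) ^ m" for m
        using fM[of m] f[of m] d by (simp add: power_divide field_simps)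
    qed
    then have "ereal (norm (d / 2)) \<le> conv_radius f" by (rule conv_radius_geI)
    moreover have "0 < ereal (norm (d / 2))" using d by simp
    ultimately show ?thesis unfolding R by (rule less_le_trans[rotated])
  qed
  moreover have "?R < \<infinity>"
  proof -
    obtain c s where s: "length s \<ge> 2" "w c s > 0" using standing_branching[OF sa] .
    then obtain a b s' where s': "s = a # b # s'" by (auto simp: numeral_2_eq_2 Suc_le_length_iff)
    have aK: "a \<le> K" using standing_bounded(3)[OF sa, of c s] s s' by auto
    define ps where "ps = (b + (a + 1)) # s'"
    define C where "C = ennreal (x * w c (a # b # s')) * (\<Prod>p\<leftarrow>ps. W w x p)"
    have "C > 0" using s s' x by (auto simp: C_def ennreal_zero_less_mult_iff prod_list_W_pos[OF sa])
    then obtain d where d: "0 < d" "d \<le> 1" "ennreal d \<le> C" by (rule ennreal_pos_real_le)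
    have step: "d * f m \<le> f (m + Suc c)" for m
    proof -
      have "ennreal d * W w x (m + K) \<le> C * W w x (m + K)"
        by (intro mult_right_mono d) auto
      also have "\<dots> \<le> W w x (c + (m + K - a) + (\<Sum>(a, p)\<leftarrow>zip (b # s') ps. p - a))"
        unfolding C_def using x aK by (intro W_ge_child[OF sa]) (auto simp: ps_def list_all2_refl)
      also have "c + (m + K - a) + (\<Sum>(a, p)\<leftarrow>zip (b # s') ps. p - a) = (m + Suc c) + K"
        using aK by (simp add: ps_def)
      finally show ?thesis using d f[of "m + Suc c"] by (simp only: W) (simp add: ennreal_mult'[symmetric])
    qed
    have iter: "d ^ n * f 0 \<le> f (n * Suc c)" for n
    proof (induction n)
      case (Suc n)
      have "d ^ Suc n * f 0 \<le> d * f (n * Suc c)" using Suc d by simp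
      also have "\<dots> \<le> f (n * Suc c + Suc c)" by (rule step)
      finally show ?case by (simp add: algebra_simps)
    qed simp
    have "\<not> summable (\<lambda>m. f m * (1 / d) ^ m)"
    proof
      assume "summable (\<lambda>m. f m * (1 / d) ^ m)"
      then have "(\<lambda>m. f m * (1 / d) ^ m) \<longlonglongrightarrow> 0" by (rule summable_LIMSEQ_zero)
      then have "((\<lambda>m. f m * (1 / d) ^ m) \<circ> (\<lambda>n. n * Suc c)) \<longlonglongrightarrow> 0"
        by (rule LIMSEQ_subseq_LIMSEQ) (simp add: strict_mono_def del: mult_Suc_right)
      moreover have "f 0 \<le> ((\<lambda>m. f m * (1 / d) ^ m) \<circ> (\<lambda>n. n * Suc c)) n" for n
      proof -
        have "f 0 \<le> f (n * Suc c) * (1 / d) ^ n" using iter[of n] d by (simp add: field_simps)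
        also have "\<dots> \<le> f (n * Suc c) * (1 / d) ^ (n * Suc c)"
          using d f[of "n * Suc c"] by (intro mult_left_mono power_increasing) auto
        finally show ?thesis by simp
      qed
      ultimately have "f 0 \<le> 0" by (intro LIMSEQ_le_const) auto
      then show False using f[of 0] by simp
    qed
    then have "conv_radius f \<le> ereal (norm (1 / d))" by (rule conv_radius_leI')
    then show ?thesis unfolding R by (rule le_less_trans) simp
  qed
  ultimately show ?thesis unfolding y_cr_def by (cases ?R) auto
qed

section \<open>Peeling off the root of the exploration\<close>

definition ll_siblings :: "ptree \<Rightarrow> nat list" where
  "ll_siblings u = take (ll_index u) (child_labels u) @ drop (Suc (ll_index u)) (child_labels u)"

fun tree_path :: "nat \<Rightarrow> ptree \<Rightarrow> (int \<times> nat list) list" where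
  "tree_path 0 T = []"
| "tree_path (Suc t) T = (int (flux (ll_child T)), ll_siblings T) # tree_path t (ll_child T)"

definition admissible :: "nat \<Rightarrow> (int \<times> nat list) list \<Rightarrow> bool" where
  "admissible K l \<longleftrightarrow> (\<forall>(s, ys)\<in>set l. int K \<le> s \<and> (\<forall>y\<in>set ys. int y < s))"

lemma admissible_simps [simp]:
  "admissible K []"
  "admissible K ((s, ys) # l) \<longleftrightarrow> int K \<le> s \<and> (\<forall>y\<in>set ys. int y < s) \<and> admissible K l"
  by (auto simp: admissible_def)

lemma ll_index_in_range:
  assumes "branches T \<noteq> []"
  shows "ll_index T < length (branches T)"
proof -
  have "Max (set (child_labels T)) \<in> set (child_labels T)"
    by (rule Max_in) (use assms in \<open>auto simp: child_labels_def\<close>)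
  then obtain i where "i < length (child_labels T) \<and> child_labels T ! i = Max (set (child_labels T))"
    by (metis in_set_conv_nth)
  then have "ll_index T < length (child_labels T)" unfolding ll_index_def by (rule LeastI2)simp
  then show ?thesis by (simp add: child_labels_def)
qed

lemma ll_insert_at:
  assumes "i \<le> length r" "\<forall>y\<in>set r. flux (snd y) < flux (snd b)" "branches T = insert_at i b r"
  shows "ll_child T = snd b" "ll_siblings T = map (\<lambda>y. flux (snd y)) r"
proof -
  let ?r = "map (\<lambda>y. flux (snd y)) r"
  have cl: "child_labels T = insert_at i (flux (snd b)) ?r"
    by (simp add: child_labels_def assms(3) map_insert_at)
  have "Max (set (child_labels T)) = flux (snd b)"
    by (rule Max_eqI) (use assms(2) in \<open>auto simp: cl set_insert_at intro: less_imp_le\<close>)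
  then have "ll_index T = (LEAST j. j < length (child_labels T) \<and> child_labels T ! j = flux (snd b))"
    by (simp only: ll_index_def)
  also have "\<dots> = i"
  proof (rule Least_equality)
    show "i < length (child_labels T) \<and> child_labels T ! i = flux (snd b)"
      using assms(1) by (simp add: cl insert_at_def nth_append)
    fix j assume j: "j < length (child_labels T) \<and> child_labels T ! j = flux (snd b)"
    show "i \<le> j"
    proof (rule ccontr)
      assume "\<not> i \<le> j"
      then have "flux (snd (r ! j)) = flux (snd b)" "j < length r"
        using j assms(1) by (auto simp: cl insert_at_def nth_append)
      then show False using assms(2) nth_mem[of j r] by fastforce
    qed
  qed
  finally have i: "ll_index T = i" .
  show "ll_child T = snd b"
    using assms(1) by (simp add: ll_child_def i assms(3) insert_at_def nth_append)
  show "ll_siblings T = ?r"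
    using assms(1) by (simp add: ll_siblings_def i cl insert_at_def)
qed

lemma num_vertices_branch: "b \<in> set (branches T) \<Longrightarrow> num_vertices (snd b) < num_vertices T"
  by (cases T) (auto simp: less_Suc_eq_le intro!: member_le_sum_list)

lemma ll_vertex_Suc: "ll_vertex T (Suc i) = ll_vertex (ll_child T) i"
  by (simp only: ll_vertex_def funpow_Suc_right o_apply)

lemma ll_reaches_leaf: "\<exists>i. branches (ll_vertex T i) = []"
proof (induction "num_vertices T" arbitrary: T rule: less_induct)
  case less
  show ?case
  proof (cases "branches T = []")
    case True
    then show ?thesis by (intro exI[of _ 0]) (simp add: ll_vertex_def)
  next
    case False
    then have "num_vertices (ll_child T) < num_vertices T"
      unfolding ll_child_def by (intro num_vertices_branch nth_mem ll_index_in_range)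
    from less[OF this] obtain i where "branches (ll_vertex (ll_child T) i) = []" ..
    then show ?thesis by (intro exI[of _ "Suc i"]) (simp only: ll_vertex_Suc)
  qed
qed

lemma Suc_le_ll_time: "Suc t \<le> ll_time T \<longleftrightarrow> branches T \<noteq> [] \<and> t \<le> ll_time (ll_child T)"
proof (cases "branches T = []")
  case True
  then have "branches (ll_vertex T 0) = []" by (simp add: ll_vertex_def)
  then have "ll_time T \<le> 0" unfolding ll_time_def by (rule Least_le)
  then show ?thesis using True by simp
next
  case False
  then have "branches (ll_vertex T 0) \<noteq> []" by (simp add: ll_vertex_def)
  moreover obtain n where "branches (ll_vertex T n) = []" using ll_reaches_leaf[of T] ..
  ultimately have "(LEAST m. branches (ll_vertex T m) = []) = Suc (LEAST m. branches (ll_vertex T (Suc m)) = [])"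
    by (intro Least_Suc)
  then have "ll_time T = Suc (ll_time (ll_child T))" by (simp only: ll_vertex_Suc ll_time_def)
  then show ?thesis using False by simp
qed

lemma admissible_insert_at:
  assumes "branches T \<noteq> []" "admissible K (tree_path (Suc t) T)"
  shows "\<exists>i b r. i \<le> length r \<and> (\<forall>y\<in>set r. flux (snd y) < flux (snd b)) \<and> branches T = insert_at i b r"
proof -
  let ?i = "ll_index T" and ?bs = "branches T"
  have i: "?i < length ?bs" by (rule ll_index_in_range) fact
  have "ll_siblings T = map (\<lambda>y. flux (snd y)) (take ?i ?bs @ drop (Suc ?i) ?bs)"
    by (simp add: ll_siblings_def child_labels_def take_map drop_map)
  then have "\<forall>y\<in>set (take ?i ?bs @ drop (Suc ?i) ?bs). flux (snd y) < flux (snd (?bs ! ?i))"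
    using assms(2) by (auto simp: ll_child_def)
  moreover have "?i \<le> length (take ?i ?bs @ drop (Suc ?i) ?bs)" using i by simp
  moreover have "?bs = insert_at ?i (?bs ! ?i) (take ?i ?bs @ drop (Suc ?i) ?bs)"
    using insert_at_nth[OF i] by simp
  ultimately show ?thesis by blast
qed

definition tree_functional ::
    "local_weight \<Rightarrow> nat \<Rightarrow> real \<Rightarrow> nat \<Rightarrow> ((int \<times> nat list) list \<Rightarrow> ennreal) \<Rightarrow> ptree \<Rightarrow> ennreal" where
  "tree_functional w K x t H T =
     (if t \<le> ll_time T \<and> admissible K (tree_path t T) then tree_mass w x T * H (tree_path t T) else 0)"

lemma tree_functional_Suc_eq_0:
  assumes "\<nexists>i b r. i \<le> length r \<and> (\<forall>y\<in>set r. flux (snd y) < flux (snd b)) \<and> bs = insert_at i b r"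
  shows "tree_functional w K x (Suc t) H (Node c bs) = 0"
proof -
  have False if "Suc t \<le> ll_time (Node c bs)" "admissible K (tree_path (Suc t) (Node c bs))"
  proof -
    have "branches (Node c bs) \<noteq> []" using that(1) Suc_le_ll_time by blast
    from admissible_insert_at[OF this that(2)] show False using assms by (simp only: ptree.sel)
  qed
  then have "\<not> (Suc t \<le> ll_time (Node c bs) \<and> admissible K (tree_path (Suc t) (Node c bs)))" by blast
  then show ?thesis unfolding tree_functional_def by (rule if_not_P)
qed

lemma tree_functional_Suc_insert_at:
  assumes sa: "standing_assumptions w K" and x: "0 \<le> x"
    and i: "i \<le> length r" "\<forall>y\<in>set r. flux (snd y) < flux (snd b)"
  shows "tree_functional w K x (Suc t) H (Node c (insert_at i b r)) =
    (if (\<forall>y\<in>set r. fst y \<le> flux (snd y)) \<and> fst b \<le> flux (snd b) \<and> K \<le> flux (snd b)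
     then ennreal (x * w c (fst b # map fst r)) *
       tree_functional w K x t (\<lambda>l. H ((int (flux (snd b)), map (\<lambda>y. flux (snd y)) r) # l)) (snd b) *
       (\<Prod>y\<leftarrow>r. tree_mass w x (snd y)) else 0)"
proof -
  let ?T = "Node c (insert_at i b r)"
  have ll: "ll_child ?T = snd b" "ll_siblings ?T = map (\<lambda>y. flux (snd y)) r"
    using ll_insert_at[OF i, of ?T] by simp_all
  have ne: "insert_at i b r \<noteq> []" by (simp add: insert_at_def)
  have w: "w c (map fst (insert_at i b r)) = w c (fst b # map fst r)"
    by (rule standing_symmetric[OF sa]) (simp add: map_insert_at mset_insert_at)
  have m: "tree_mass w x ?T =
     (if fst b \<le> flux (snd b) \<and> (\<forall>y\<in>set r. fst y \<le> flux (snd y))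
      then ennreal (x * w c (fst b # map fst r)) * (tree_mass w x (snd b) * (\<Prod>y\<leftarrow>r. tree_mass w x (snd y)))
      else 0)"
    unfolding tree_mass_Node[OF standing_nonneg[OF sa] x] w
    by (simp add: set_insert_at map_insert_at prod_list_insert_at)
  show ?thesis
    using i(2) ne by (simp add: tree_functional_def Suc_le_ll_time ll m mult_ac)
qed

lemma flux_Node_insert_at:
  "flux (Node c (insert_at i b r)) = c + ((flux (snd b) - fst b) + (\<Sum>y\<leftarrow>r. flux (snd y) - fst y))"
  by (simp add: map_insert_at sum_list_insert_at)

lemma tree_functional_Suc:
  assumes sa: "standing_assumptions w K" and x: "0 \<le> x"
  shows "(\<integral>\<^sup>+T. (if flux T = p then tree_functional w K x (Suc t) H T else 0) \<partial>count_space UNIV) =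
    (\<integral>\<^sup>+c. \<integral>\<^sup>+s. \<integral>\<^sup>+q. \<integral>\<^sup>+sp.
       (if (\<forall>b\<in>set sp. fst b \<le> snd b) \<and> s \<le> q \<and> c + ((q - s) + (\<Sum>b\<leftarrow>sp. snd b - fst b)) = p
        then of_nat (Suc (length sp)) * ennreal (x * w c (s # map fst sp)) else 0) *
       (\<Prod>b\<leftarrow>sp. W w x (snd b)) *
       (if K \<le> q \<and> (\<forall>y\<in>set (map snd sp). y < q) then
         \<integral>\<^sup>+T. (if flux T = q then tree_functional w K x t (\<lambda>l. H ((int q, map snd sp) # l)) T else 0)
          \<partial>count_space UNIV else 0)
     \<partial>count_space UNIV \<partial>count_space UNIV \<partial>count_space UNIV \<partial>count_space UNIV)"
proof -
  define J where "J c s sp q T =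
      (if (\<forall>b\<in>set sp. fst b \<le> snd b) \<and> s \<le> q \<and> c + ((q - s) + (\<Sum>b\<leftarrow>sp. snd b - fst b)) = p
        then of_nat (Suc (length sp)) * ennreal (x * w c (s # map fst sp)) else 0) *
      (if K \<le> q \<and> (\<forall>y\<in>set (map snd sp). y < q) then
         tree_functional w K x t (\<lambda>l. H ((int q, map snd sp) # l)) T else 0)" for c s sp q T
  have rearrange: "(if A then n * (if B \<and> C \<and> D \<and> E then k * F * M else 0) else 0) =
      (if C \<and> D \<and> B then n * k else 0) * (if E \<and> A then F else 0) * M"
    for A B C D E and n k F M :: ennreal by (simp add: mult_ac)
  let ?m = "map (map_prod id flux)"
  have "(\<integral>\<^sup>+T. (if flux T = p then tree_functional w K x (Suc t) H T else 0) \<partial>count_space UNIV) =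
    (\<integral>\<^sup>+c. \<integral>\<^sup>+bs. (if flux (Node c bs) = p then tree_functional w K x (Suc t) H (Node c bs) else 0)
      \<partial>count_space UNIV \<partial>count_space UNIV)"
    by (rule nn_integral_ptree)
  also have "\<dots> = (\<integral>\<^sup>+c. \<integral>\<^sup>+b. \<integral>\<^sup>+r. (if \<forall>y\<in>set r. flux (snd y) < flux (snd b) then
     of_nat (Suc (length r)) * (if c + ((flux (snd b) - fst b) + (\<Sum>y\<leftarrow>r. flux (snd y) - fst y)) = p \<and>
       (\<forall>y\<in>set r. fst y \<le> flux (snd y)) \<and> fst b \<le> flux (snd b) \<and> K \<le> flux (snd b)
     then ennreal (x * w c (fst b # map fst r)) *
       tree_functional w K x t (\<lambda>l. H ((int (flux (snd b)), map (\<lambda>y. flux (snd y)) r) # l)) (snd b) *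
       (\<Prod>y\<leftarrow>r. tree_mass w x (snd y)) else 0) else 0)
      \<partial>count_space UNIV \<partial>count_space UNIV \<partial>count_space UNIV)"
  proof (intro nn_integral_cong nn_integral_strict_max)
    fix c :: nat and l :: "(nat \<times> ptree) list"
    assume "\<nexists>i b r. i \<le> length r \<and> (\<forall>y\<in>set r. flux (snd y) < flux (snd b)) \<and> l = insert_at i b r"
    then have "tree_functional w K x (Suc t) H (Node c l) = 0" by (rule tree_functional_Suc_eq_0)
    then show "(if flux (Node c l) = p then tree_functional w K x (Suc t) H (Node c l) else 0) = 0"
      by (simp only: if_cancel)
  next
    fix c i :: nat and b :: "nat \<times> ptree" and r :: "(nat \<times> ptree) list"
    assume i: "i \<le> length r" "\<forall>y\<in>set r. flux (snd y) < flux (snd b)"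
    show "(if flux (Node c (insert_at i b r)) = p
        then tree_functional w K x (Suc t) H (Node c (insert_at i b r)) else 0) =
      (if c + ((flux (snd b) - fst b) + (\<Sum>y\<leftarrow>r. flux (snd y) - fst y)) = p \<and>
       (\<forall>y\<in>set r. fst y \<le> flux (snd y)) \<and> fst b \<le> flux (snd b) \<and> K \<le> flux (snd b)
     then ennreal (x * w c (fst b # map fst r)) *
       tree_functional w K x t (\<lambda>l. H ((int (flux (snd b)), map (\<lambda>y. flux (snd y)) r) # l)) (snd b) *
       (\<Prod>y\<leftarrow>r. tree_mass w x (snd y)) else 0)"
      unfolding flux_Node_insert_at tree_functional_Suc_insert_at[OF sa x i] by auto
  qed
  also have "\<dots> = (\<integral>\<^sup>+c. \<integral>\<^sup>+s. \<integral>\<^sup>+T. \<integral>\<^sup>+r. J c s (?m r) (flux T) T * (\<Prod>y\<leftarrow>r. tree_mass w x (snd y))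
      \<partial>count_space UNIV \<partial>count_space UNIV \<partial>count_space UNIV \<partial>count_space UNIV)"
  proof (rule nn_integral_cong)
    fix c :: nat
    show "(\<integral>\<^sup>+b. \<integral>\<^sup>+r. (if \<forall>y\<in>set r. flux (snd y) < flux (snd b) then
     of_nat (Suc (length r)) * (if c + ((flux (snd b) - fst b) + (\<Sum>y\<leftarrow>r. flux (snd y) - fst y)) = p \<and>
       (\<forall>y\<in>set r. fst y \<le> flux (snd y)) \<and> fst b \<le> flux (snd b) \<and> K \<le> flux (snd b)
     then ennreal (x * w c (fst b # map fst r)) *
       tree_functional w K x t (\<lambda>l. H ((int (flux (snd b)), map (\<lambda>y. flux (snd y)) r) # l)) (snd b) *
       (\<Prod>y\<leftarrow>r. tree_mass w x (snd y)) else 0) else 0)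
      \<partial>count_space UNIV \<partial>count_space UNIV) =
      (\<integral>\<^sup>+s. \<integral>\<^sup>+T. \<integral>\<^sup>+r. J c s (?m r) (flux T) T * (\<Prod>y\<leftarrow>r. tree_mass w x (snd y))
      \<partial>count_space UNIV \<partial>count_space UNIV \<partial>count_space UNIV)"
      unfolding nn_integral_count_space_Sigma
    proof (intro nn_integral_cong)
      fix s :: nat and T :: ptree and r :: "(nat \<times> ptree) list"
      have m: "map fst (?m r) = map fst r" "map snd (?m r) = map (\<lambda>y. flux (snd y)) r"
        "(\<Sum>b\<leftarrow>?m r. snd b - fst b) = (\<Sum>y\<leftarrow>r. flux (snd y) - fst y)"
        "(\<forall>b\<in>set (?m r). fst b \<le> snd b) \<longleftrightarrow> (\<forall>y\<in>set r. fst y \<le> flux (snd y))"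
        "(\<forall>y\<in>set (map (\<lambda>y. flux (snd y)) r). y < flux T) \<longleftrightarrow> (\<forall>y\<in>set r. flux (snd y) < flux T)"
        by (simp_all add: comp_def)
      show "(if \<forall>y\<in>set r. flux (snd y) < flux (snd (s, T)) then
     of_nat (Suc (length r)) * (if c + ((flux (snd (s, T)) - fst (s, T)) + (\<Sum>y\<leftarrow>r. flux (snd y) - fst y)) = p \<and>
       (\<forall>y\<in>set r. fst y \<le> flux (snd y)) \<and> fst (s, T) \<le> flux (snd (s, T)) \<and> K \<le> flux (snd (s, T))
     then ennreal (x * w c (fst (s, T) # map fst r)) *
       tree_functional w K x t (\<lambda>l. H ((int (flux (snd (s, T))), map (\<lambda>y. flux (snd y)) r) # l)) (snd (s, T)) *
       (\<Prod>y\<leftarrow>r. tree_mass w x (snd y)) else 0) else 0) =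
       J c s (?m r) (flux T) T * (\<Prod>y\<leftarrow>r. tree_mass w x (snd y))"
        unfolding J_def m length_map fst_conv snd_conv
        by (rule rearrange)
    qed
  qed
  also have "\<dots> = (\<integral>\<^sup>+c. \<integral>\<^sup>+s. \<integral>\<^sup>+T. \<integral>\<^sup>+sp. J c s sp (flux T) T * (\<Prod>b\<leftarrow>sp. W w x (snd b))
      \<partial>count_space UNIV \<partial>count_space UNIV \<partial>count_space UNIV \<partial>count_space UNIV)"
    by (intro nn_integral_cong nn_integral_branches standing_nonneg[OF sa] x)
  also have "\<dots> = (\<integral>\<^sup>+c. \<integral>\<^sup>+s. \<integral>\<^sup>+q. \<integral>\<^sup>+T. (if flux T = q then
      \<integral>\<^sup>+sp. J c s sp q T * (\<Prod>b\<leftarrow>sp. W w x (snd b)) \<partial>count_space UNIV else 0)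
      \<partial>count_space UNIV \<partial>count_space UNIV \<partial>count_space UNIV \<partial>count_space UNIV)"
    by (intro nn_integral_cong nn_integral_count_space_fibre)
  also have "\<dots> = (\<integral>\<^sup>+c. \<integral>\<^sup>+s. \<integral>\<^sup>+q. \<integral>\<^sup>+sp. \<integral>\<^sup>+T.
      (\<Prod>b\<leftarrow>sp. W w x (snd b)) * (if flux T = q then J c s sp q T else 0)
      \<partial>count_space UNIV \<partial>count_space UNIV \<partial>count_space UNIV \<partial>count_space UNIV \<partial>count_space UNIV)"
    by (intro nn_integral_cong, subst nn_integral_count_space_swap)
       (intro nn_integral_cong, auto simp: mult.commute intro!: nn_integral_cong)
  also have "\<dots> = (\<integral>\<^sup>+c. \<integral>\<^sup>+s. \<integral>\<^sup>+q. \<integral>\<^sup>+sp.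
       (if (\<forall>b\<in>set sp. fst b \<le> snd b) \<and> s \<le> q \<and> c + ((q - s) + (\<Sum>b\<leftarrow>sp. snd b - fst b)) = p
        then of_nat (Suc (length sp)) * ennreal (x * w c (s # map fst sp)) else 0) *
       (\<Prod>b\<leftarrow>sp. W w x (snd b)) *
       (if K \<le> q \<and> (\<forall>y\<in>set (map snd sp). y < q) then
         \<integral>\<^sup>+T. (if flux T = q then tree_functional w K x t (\<lambda>l. H ((int q, map snd sp) # l)) T else 0)
          \<partial>count_space UNIV else 0)
     \<partial>count_space UNIV \<partial>count_space UNIV \<partial>count_space UNIV \<partial>count_space UNIV)"
  proof (intro nn_integral_cong)
    fix c s q :: nat and sp :: "(nat \<times> nat) list"
    let ?k = "(if (\<forall>b\<in>set sp. fst b \<le> snd b) \<and> s \<le> q \<and> c + ((q - s) + (\<Sum>b\<leftarrow>sp. snd b - fst b)) = p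
        then of_nat (Suc (length sp)) * ennreal (x * w c (s # map fst sp)) else 0) :: ennreal"
    let ?F = "\<lambda>T. (if flux T = q then tree_functional w K x t (\<lambda>l. H ((int q, map snd sp) # l)) T else 0)"
    have "(\<integral>\<^sup>+T. (\<Prod>b\<leftarrow>sp. W w x (snd b)) * (if flux T = q then J c s sp q T else 0) \<partial>count_space UNIV)
       = (\<integral>\<^sup>+T. ?k * (\<Prod>b\<leftarrow>sp. W w x (snd b)) * (if K \<le> q \<and> (\<forall>y\<in>set (map snd sp). y < q) then ?F T else 0)
           \<partial>count_space UNIV)"
      by (intro nn_integral_cong) (simp add: J_def mult_ac)
    also have "\<dots> = ?k * (\<Prod>b\<leftarrow>sp. W w x (snd b)) *
        (\<integral>\<^sup>+T. (if K \<le> q \<and> (\<forall>y\<in>set (map snd sp). y < q) then ?F T else 0) \<partial>count_space UNIV)"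
      by (rule nn_integral_cmult) simp
    also have "(\<integral>\<^sup>+T. (if K \<le> q \<and> (\<forall>y\<in>set (map snd sp). y < q) then ?F T else 0) \<partial>count_space UNIV)
       = (if K \<le> q \<and> (\<forall>y\<in>set (map snd sp). y < q) then \<integral>\<^sup>+T. ?F T \<partial>count_space UNIV else 0)"
      by (rule nn_integral_if)
    finally show "(\<integral>\<^sup>+T. (\<Prod>b\<leftarrow>sp. W w x (snd b)) * (if flux T = q then J c s sp q T else 0) \<partial>count_space UNIV)
       = ?k * (\<Prod>b\<leftarrow>sp. W w x (snd b)) *
        (if K \<le> q \<and> (\<forall>y\<in>set (map snd sp). y < q) then \<integral>\<^sup>+T. ?F T \<partial>count_space UNIV else 0)" .
  qed
  finally show ?thesis .
qed

section \<open>The random walk\<close>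

fun walk_path :: "nat \<Rightarrow> nat \<Rightarrow> int \<Rightarrow> (nat \<Rightarrow> step) \<Rightarrow> (int \<times> nat list) list" where
  "walk_path a 0 p \<omega> = []"
| "walk_path a (Suc t) p \<omega> =
    (p + fst (\<omega> (Suc a)), rw_Y \<omega> (Suc a)) # walk_path (Suc a) t (p + fst (\<omega> (Suc a))) \<omega>"

definition path_end :: "int \<Rightarrow> (int \<times> nat list) list \<Rightarrow> int" where
  "path_end p l = (if l = [] then p else fst (last l))"

lemma path_end_simps [simp]:
  "path_end p [] = p"
  "path_end p ((s, ys) # l) = path_end s l"
  by (auto simp: path_end_def)

lemma walk_path_fun_upd:
  "i \<le> a \<Longrightarrow> walk_path a t p (fun_upd \<omega> i z) = walk_path a t p \<omega>"
  by (induction t arbitrary: a p) (auto simp: rw_Y_def)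

lemma measurable_PiM_nu_hat:
  assumes "finite I"
  shows "(f :: _ \<Rightarrow> ennreal) \<in> borel_measurable (PiM I (\<lambda>_. nu_hat_measure w K x))"
proof -
  have "sets (PiM I (\<lambda>_. nu_hat_measure w K x)) = sets (PiM I (\<lambda>_. count_space (UNIV :: step set)))"
    by (rule sets_PiM_cong) (simp_all add: nu_hat_measure_def)
  also have "PiM I (\<lambda>_. count_space (UNIV :: step set)) = count_space (PiE I (\<lambda>_. UNIV))"
    using assms by (intro count_space_PiM_finite) auto
  finally have "(borel_measurable (PiM I (\<lambda>_. nu_hat_measure w K x)) :: (_ \<Rightarrow> ennreal) set) =
     borel_measurable (count_space (PiE I (\<lambda>_. UNIV :: step set)))"
    by (intro measurable_cong_sets) simp_all
  then show ?thesis by simp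
qed

lemma sigma_finite_nu_hat: "sigma_finite_measure (nu_hat_measure w K x)"
proof -
  interpret sigma_finite_measure "count_space (UNIV :: step set)"
    by (rule sigma_finite_measure_count_space)
  show ?thesis unfolding nu_hat_measure_def by (subst sigma_finite_iff_density_finite) auto
qed

lemma nn_integral_walk_path_Suc:
  "(\<integral>\<^sup>+\<omega>. F (walk_path a (Suc t) p \<omega>) \<partial>PiM {Suc a..a + Suc t} (\<lambda>_. nu_hat_measure w K x)) =
   (\<integral>\<^sup>+z. ennreal (nu_hat w K x z) *
     (\<integral>\<^sup>+\<omega>. F ((p + fst z, snd (snd (snd z))) # walk_path (Suc a) t (p + fst z) \<omega>)
      \<partial>PiM {Suc (Suc a)..Suc a + t} (\<lambda>_. nu_hat_measure w K x)) \<partial>count_space UNIV)"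
proof -
  interpret product_sigma_finite "\<lambda>_ :: nat. nu_hat_measure w K x"
    by (intro product_sigma_finite.intro sigma_finite_nu_hat)
  have "{Suc a..a + Suc t} = insert (Suc a) {Suc (Suc a)..Suc a + t}" by auto
  then have "(\<integral>\<^sup>+\<omega>. F (walk_path a (Suc t) p \<omega>) \<partial>PiM {Suc a..a + Suc t} (\<lambda>_. nu_hat_measure w K x)) =
     (\<integral>\<^sup>+\<omega>. F (walk_path a (Suc t) p \<omega>)
       \<partial>PiM (insert (Suc a) {Suc (Suc a)..Suc a + t}) (\<lambda>_. nu_hat_measure w K x))"
    by simp
  also have "\<dots> = (\<integral>\<^sup>+z. \<integral>\<^sup>+\<omega>. F (walk_path a (Suc t) p (fun_upd \<omega> (Suc a) z))
      \<partial>PiM {Suc (Suc a)..Suc a + t} (\<lambda>_. nu_hat_measure w K x) \<partial>nu_hat_measure w K x)"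
    by (rule product_nn_integral_insert_rev) (simp_all only: measurable_PiM_nu_hat finite_insert finite_atLeastAtMost, simp)
  also have "\<dots> = (\<integral>\<^sup>+z. \<integral>\<^sup>+\<omega>. F ((p + fst z, snd (snd (snd z))) # walk_path (Suc a) t (p + fst z) \<omega>)
      \<partial>PiM {Suc (Suc a)..Suc a + t} (\<lambda>_. nu_hat_measure w K x) \<partial>nu_hat_measure w K x)"
    by (simp add: walk_path_fun_upd rw_Y_def)
  finally show ?thesis by (simp add: nu_hat_measure_def nn_integral_density)
qed

lemma prod_list_ennreal:
  "(\<And>b. b \<in> set l \<Longrightarrow> 0 \<le> g b) \<Longrightarrow> (\<Prod>b\<leftarrow>l. ennreal (g b)) = ennreal (\<Prod>b\<leftarrow>l. g b)"
  by (induction l) (auto simp: ennreal_mult' )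

lemma int_sum_list_diff:
  "\<forall>b\<in>set l. fst b \<le> snd b \<Longrightarrow>
   int (\<Sum>b\<leftarrow>l. snd b - fst b) = int (sum_list (map snd l)) - int (sum_list (map fst l))"
  by (induction l) auto

lemma nu_hat_coefficient:
  assumes sa: "standing_assumptions w K" and x: "0 < x" "ereal x \<le> x_cr w" and q: "K \<le> q"
  shows "ennreal (nu_hat w K x (int q - int p, c, s # map fst sp, map snd sp)) *
       ennreal (y_cr w x powi (int q - int p)) =
    (if (\<forall>b\<in>set sp. fst b \<le> snd b) \<and> s \<le> q \<and> c + ((q - s) + (\<Sum>b\<leftarrow>sp. snd b - fst b)) = p
        then of_nat (Suc (length sp)) * ennreal (x * w c (s # map fst sp)) else 0) *
       (\<Prod>b\<leftarrow>sp. W w x (snd b))"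
proof (cases "w c (s # map fst sp) = 0")
  case True
  then show ?thesis by (simp add: nu_hat_def)
next
  case False
  then have w: "w c (s # map fst sp) > 0" using standing_nonneg[OF sa, of c "s # map fst sp"] by simp
  have len: "length sp < K" and s: "s \<le> q"
    using standing_bounded[OF sa False] q by auto
  have all2: "list_all2 (\<le>) (map fst sp) (map snd sp) \<longleftrightarrow> (\<forall>b\<in>set sp. fst b \<le> snd b)"
    by (simp add: list_all2_map1 list_all2_map2 list_all2_same)
  show ?thesis
  proof (cases "(\<forall>b\<in>set sp. fst b \<le> snd b) \<and> c + ((q - s) + (\<Sum>b\<leftarrow>sp. snd b - fst b)) = p")
    case False
    have "nu_hat w K x (int q - int p, c, s # map fst sp, map snd sp) = 0"
    proof (cases "\<forall>b\<in>set sp. fst b \<le> snd b")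
      case True
      from int_sum_list_diff[OF True] have "int (sum_list (map snd sp)) - int (sum_list (s # map fst sp)) + int c \<noteq> - (int q - int p)"
        using False True s by auto
      then show ?thesis by (simp only: nu_hat_def prod.case if_not_P simp_thms)
    next
      case False
      then show ?thesis by (simp only: nu_hat_def prod.case all2 list.sel simp_thms if_False)
    qed
    then show ?thesis using False by (simp only: simp_thms if_False mult_zero_left ennreal_0) auto
  next
    case True
    have "W w x (snd b) = ennreal (enn2real (W w x (snd b)))" if b: "b \<in> set sp" for b
    proof -
      have "W w x (snd b) < \<infinity>"
        by (rule W_finite[OF sa x w, where a = "fst b"]) (use b True in \<open>auto simp: Suc_le_eq\<close>)
      then show ?thesis by simp
    qed
    then have "map (\<lambda>b. W w x (snd b)) sp = map (\<lambda>b. ennreal (enn2real (W w x (snd b)))) sp"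
      by (intro map_cong) auto
    then have W: "(\<Prod>b\<leftarrow>sp. W w x (snd b)) = ennreal (\<Prod>b\<leftarrow>sp. enn2real (W w x (snd b)))"
      by (simp only: prod_list_ennreal enn2real_nonneg)
    have y: "y_cr w x powi (- (int q - int p)) * y_cr w x powi (int q - int p) = 1"
      using y_cr_pos[OF sa x] by (subst power_int_add[symmetric]) auto
    have "int (sum_list (map snd sp)) - int (sum_list (s # map fst sp)) + int c = - (int q - int p)"
      using True s int_sum_list_diff[of sp] by auto
    then have cond: "length (s # map fst sp) = Suc (length (map snd sp)) \<and> length (map snd sp) < K \<and>
        int (sum_list (map snd sp)) - int (sum_list (s # map fst sp)) + int c = - (int q - int p) \<and>
        list_all2 (\<le>) (tl (s # map fst sp)) (map snd sp)"
      using len conjunct1[OF True] all2 by (simp only: length_map list.sel list.size(4) simp_thms) simp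
    have nu: "nu_hat w K x (int q - int p, c, s # map fst sp, map snd sp) =
       x * y_cr w x powi (- (int q - int p)) * real (Suc (length sp)) * w c (s # map fst sp) *
       (\<Prod>b\<leftarrow>sp. enn2real (W w x (snd b)))"
      unfolding nu_hat_def prod.case if_P[OF cond] by (simp add: comp_def)
    have pr: "0 \<le> (\<Prod>b\<leftarrow>sp. enn2real (W w x (snd b)))"
      by (rule prod_list_nonneg) auto
    have "ennreal (nu_hat w K x (int q - int p, c, s # map fst sp, map snd sp)) *
       ennreal (y_cr w x powi (int q - int p)) =
       ennreal (nu_hat w K x (int q - int p, c, s # map fst sp, map snd sp) * y_cr w x powi (int q - int p))"
      using y_cr_pos[OF sa x] by (intro ennreal_mult''[symmetric]) (simp add: less_imp_le)
    also have "nu_hat w K x (int q - int p, c, s # map fst sp, map snd sp) * y_cr w x powi (int q - int p) =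
       (real (Suc (length sp)) * (x * w c (s # map fst sp))) * (\<Prod>b\<leftarrow>sp. enn2real (W w x (snd b))) *
       (y_cr w x powi (- (int q - int p)) * y_cr w x powi (int q - int p))"
      unfolding nu by (simp only: mult_ac)
    also have "\<dots> = (real (Suc (length sp)) * (x * w c (s # map fst sp))) * (\<Prod>b\<leftarrow>sp. enn2real (W w x (snd b)))"
      unfolding y by simp
    also have "ennreal \<dots> = of_nat (Suc (length sp)) * ennreal (x * w c (s # map fst sp)) *
       (\<Prod>b\<leftarrow>sp. W w x (snd b))"
      unfolding W using x w pr by (simp only: ennreal_mult' ennreal_of_nat_eq_real_of_nat
        mult_nonneg_nonneg less_imp_le of_nat_0_le_iff)
    finally show ?thesis using True s by simp
  qed
qed

definition walk_functional ::
    "local_weight \<Rightarrow> nat \<Rightarrow> real \<Rightarrow> int \<Rightarrow> ((int \<times> nat list) list \<Rightarrow> ennreal) \<Rightarrow> (int \<times> nat list) list \<Rightarrow> ennreal"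
  where "walk_functional w K x p H l = (if admissible K l
    then ennreal (y_cr w x powi (path_end p l - p)) * W w x (nat (path_end p l)) * H l else 0)"

lemma walk_functional_Cons:
  assumes "standing_assumptions w K" "0 < x" "ereal x \<le> x_cr w"
  shows "walk_functional w K x p H ((s, ys) # l) =
    (if int K \<le> s \<and> (\<forall>y\<in>set ys. int y < s) then ennreal (y_cr w x powi (s - p)) else 0) *
    walk_functional w K x s (\<lambda>l. H ((s, ys) # l)) l"
proof -
  have "y_cr w x powi (path_end s l - p) = y_cr w x powi (s - p) * y_cr w x powi (path_end s l - s)"
    using y_cr_pos[OF assms] by (subst power_int_add[symmetric]) auto
  then have "ennreal (y_cr w x powi (path_end s l - p)) =
      ennreal (y_cr w x powi (s - p)) * ennreal (y_cr w x powi (path_end s l - s))"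
    using y_cr_pos[OF assms] by (simp add: ennreal_mult' less_imp_le)
  then show ?thesis by (simp add: walk_functional_def mult_ac)
qed

lemma nn_integral_tree_functional:
  assumes sa: "standing_assumptions w K" and x: "0 < x" "ereal x \<le> x_cr w" and p: "K \<le> p"
  shows "(\<integral>\<^sup>+T. (if flux T = p then tree_functional w K x t H T else 0) \<partial>count_space UNIV) =
    (\<integral>\<^sup>+\<omega>. walk_functional w K x (int p) H (walk_path a t (int p) \<omega>)
      \<partial>PiM {Suc a..a + t} (\<lambda>_. nu_hat_measure w K x))"
  using p
proof (induction t arbitrary: a p H)
  case 0
  interpret product_sigma_finite "\<lambda>_ :: nat. nu_hat_measure w K x"
    by (intro product_sigma_finite.intro sigma_finite_nu_hat)
  have "(\<integral>\<^sup>+T. (if flux T = p then tree_functional w K x 0 H T else 0) \<partial>count_space UNIV) =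
    (\<integral>\<^sup>+T. H [] * (if flux T = p then tree_mass w x T else 0) \<partial>count_space UNIV)"
    by (intro nn_integral_cong) (simp add: tree_functional_def mult.commute)
  also have "\<dots> = H [] * W w x p"
    using x by (simp add: nn_integral_cmult W_eq_nn_integral[OF standing_nonneg[OF sa]])
  finally show ?case
    by (simp add: PiM_empty nn_integral_count_space_finite walk_functional_def mult.commute)
next
  case (Suc t)
  define B where "B z =
     (if int K \<le> int p + fst z \<and> (\<forall>y\<in>set (snd (snd (snd z))). int y < int p + fst z)
      then ennreal (nu_hat w K x z) * ennreal (y_cr w x powi (fst z)) *
       (\<integral>\<^sup>+T. (if flux T = nat (int p + fst z) then
         tree_functional w K x t (\<lambda>l. H ((int p + fst z, snd (snd (snd z))) # l)) T else 0)
        \<partial>count_space UNIV) else 0)" for z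
  define g where "g = (\<lambda>(c, s, q, sp). (int q - int p, c, s # map fst sp, map snd sp) :: step)"
  have "(\<integral>\<^sup>+\<omega>. walk_functional w K x (int p) H (walk_path a (Suc t) (int p) \<omega>)
      \<partial>PiM {Suc a..a + Suc t} (\<lambda>_. nu_hat_measure w K x)) = (\<integral>\<^sup>+z. B z \<partial>count_space UNIV)"
    unfolding nn_integral_walk_path_Suc
  proof (intro nn_integral_cong)
    fix z :: step
    let ?s = "int p + fst z" and ?ys = "snd (snd (snd z))"
    let ?M = "PiM {Suc (Suc a)..Suc a + t} (\<lambda>_. nu_hat_measure w K x)"
    let ?k = "(if int K \<le> ?s \<and> (\<forall>y\<in>set ?ys. int y < ?s) then ennreal (y_cr w x powi (?s - int p)) else 0)"
    have "(\<integral>\<^sup>+\<omega>. walk_functional w K x (int p) H ((?s, ?ys) # walk_path (Suc a) t ?s \<omega>) \<partial>?M) =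
       ?k * (\<integral>\<^sup>+\<omega>. walk_functional w K x ?s (\<lambda>l. H ((?s, ?ys) # l)) (walk_path (Suc a) t ?s \<omega>) \<partial>?M)"
      unfolding walk_functional_Cons[OF sa x]
      by (rule nn_integral_cmult) (rule measurable_PiM_nu_hat, simp)
    also have "ennreal (nu_hat w K x z) * \<dots> = B z"
    proof (cases "int K \<le> ?s \<and> (\<forall>y\<in>set ?ys. int y < ?s)")
      case True
      then have "K \<le> nat ?s" "int (nat ?s) = ?s" by auto
      from Suc.IH[OF this(1), of "\<lambda>l. H ((?s, ?ys) # l)" "Suc a"] this(2) True
      show ?thesis by (simp add: B_def mult_ac)
    next
      case False
      then show ?thesis by (auto simp: B_def)
    qed
    finally show "ennreal (nu_hat w K x z) *
      (\<integral>\<^sup>+\<omega>. walk_functional w K x (int p) H ((?s, ?ys) # walk_path (Suc a) t ?s \<omega>) \<partial>?M) = B z" .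
  qed
  also have "\<dots> = (\<integral>\<^sup>+z. (if z \<in> UNIV then B (g z) else 0) \<partial>count_space UNIV)"
  proof (rule nn_integral_count_space_inj)
    show "inj_on g UNIV"
      by (auto simp: inj_on_def g_def intro: zip_map_fst_snd[THEN subst] dest!: pair_list_eqI)
    fix z assume z: "z \<notin> range g"
    obtain q c s ps where zeq: "z = (q, c, s, ps)" by (cases z)
    show "B z = 0"
    proof (rule ccontr)
      assume "B z \<noteq> 0"
      then have "int K \<le> int p + q" "nu_hat w K x z \<noteq> 0" by (auto simp: B_def zeq split: if_splits)
      then have "length s = Suc (length ps)" by (auto simp: nu_hat_def zeq split: if_splits)
      then obtain s0 s' where s: "s = s0 # s'" "length s' = length ps" by (cases s) auto
      have "z = g (c, s0, nat (int p + q), zip s' ps)"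
        using s \<open>int K \<le> int p + q\<close> by (simp add: g_def zeq)
      then show False using z by blast
    qed
  qed
  also have "\<dots> = (\<integral>\<^sup>+c. \<integral>\<^sup>+s. \<integral>\<^sup>+q. \<integral>\<^sup>+sp. B (g (c, s, q, sp))
      \<partial>count_space UNIV \<partial>count_space UNIV \<partial>count_space UNIV \<partial>count_space UNIV)"
    by (simp add: nn_integral_count_space_Sigma)
  also have "\<dots> = (\<integral>\<^sup>+T. (if flux T = p then tree_functional w K x (Suc t) H T else 0) \<partial>count_space UNIV)"
    unfolding tree_functional_Suc[OF sa less_imp_le[OF x(1)]]
  proof (intro nn_integral_cong)
    fix c s q :: nat and sp :: "(nat \<times> nat) list"
    let ?k = "(if (\<forall>b\<in>set sp. fst b \<le> snd b) \<and> s \<le> q \<and> c + ((q - s) + (\<Sum>b\<leftarrow>sp. snd b - fst b)) = p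
        then of_nat (Suc (length sp)) * ennreal (x * w c (s # map fst sp)) else 0) :: ennreal"
    let ?I = "\<integral>\<^sup>+T. (if flux T = q then tree_functional w K x t (\<lambda>l. H ((int q, map snd sp) # l)) T else 0)
        \<partial>count_space UNIV"
    show "B (g (c, s, q, sp)) = ?k * (\<Prod>b\<leftarrow>sp. W w x (snd b)) *
        (if K \<le> q \<and> (\<forall>y\<in>set (map snd sp). y < q) then ?I else 0)"
    proof (cases "K \<le> q \<and> (\<forall>y\<in>set (map snd sp). y < q)")
      case True
      have g: "int p + (int q - int p) = int q" "fst (g (c, s, q, sp)) = int q - int p"
        "snd (snd (snd (g (c, s, q, sp)))) = map snd sp" by (simp_all add: g_def)
      have "B (g (c, s, q, sp)) = ennreal (nu_hat w K x (int q - int p, c, s # map fst sp, map snd sp)) *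
         ennreal (y_cr w x powi (int q - int p)) * ?I"
        using True unfolding B_def g by (simp add: g_def)
      also have "\<dots> = ?k * (\<Prod>b\<leftarrow>sp. W w x (snd b)) * ?I"
        using nu_hat_coefficient[OF sa x, of q p c s sp] True by (simp only:)
      finally show ?thesis unfolding if_P[OF True] .
    next
      case False
      then have "B (g (c, s, q, sp)) = 0" by (auto simp: B_def g_def)
      then show ?thesis using False by (simp only: if_False mult_zero_right)
    qed
  qed
  finally show ?case ..
qed

section \<open>Paths as lists\<close>

lemma upt_Suc_Suc: "[Suc a..<Suc (a + Suc t)] = Suc a # [Suc (Suc a)..<Suc (Suc a + t)]"
  by (simp add: upt_conv_Cons del: upt_Suc)

lemma tree_path_eq_map: "tree_path t T = map (\<lambda>i. (tree_S T i, tree_Y T i)) [1..<Suc t]"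
proof (induction t arbitrary: T)
  case (Suc t)
  have S: "tree_S T (Suc i) = tree_S (ll_child T) i" for i
    by (simp add: tree_S_def ll_vertex_Suc)
  have Y: "tree_Y T (Suc (Suc i)) = tree_Y (ll_child T) (Suc i)" for i
    by (simp add: tree_Y_def ll_vertex_Suc)
  have "map (\<lambda>i. (tree_S T i, tree_Y T i)) [1..<Suc (Suc t)] =
      (tree_S T 1, tree_Y T 1) # map (\<lambda>i. (tree_S T i, tree_Y T i)) (map Suc [1..<Suc t])"
    using upt_Suc_Suc[of 0 t] by (simp add: map_Suc_upt del: upt_Suc)
  also have "map (\<lambda>i. (tree_S T i, tree_Y T i)) (map Suc [1..<Suc t]) = tree_path t (ll_child T)"
    unfolding Suc.IH map_map
  proof (rule map_cong)
    fix i assume "i \<in> set [1..<Suc t]"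
    then have "1 \<le> i" by (simp only: set_upt atLeastLessThan_iff)
    then obtain j where "i = Suc j" by (cases i) auto
    then show "((\<lambda>i. (tree_S T i, tree_Y T i)) \<circ> Suc) i = (tree_S (ll_child T) i, tree_Y (ll_child T) i)"
      by (simp add: S Y)
  qed simp
  also have "(tree_S T 1, tree_Y T 1) = (int (flux (ll_child T)), ll_siblings T)"
    by (simp add: tree_S_def tree_Y_def ll_siblings_def Let_def ll_vertex_def)
  finally show ?case by simp
qed simp

lemma walk_path_eq_map:
  "walk_path a t p \<omega> = map (\<lambda>i. (p + (\<Sum>j\<in>{Suc a..i}. fst (\<omega> j)), rw_Y \<omega> i)) [Suc a..<Suc (a + t)]"
proof (induction t arbitrary: a p)
  case (Suc t)
  have "map (\<lambda>i. (p + fst (\<omega> (Suc a)) + (\<Sum>j\<in>{Suc (Suc a)..i}. fst (\<omega> j)), rw_Y \<omega> i))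
        [Suc (Suc a)..<Suc (Suc a + t)] =
      map (\<lambda>i. (p + (\<Sum>j\<in>{Suc a..i}. fst (\<omega> j)), rw_Y \<omega> i)) [Suc (Suc a)..<Suc (Suc a + t)]"
    by (rule map_cong) (auto simp: sum.atLeast_Suc_atMost[of "Suc a"])
  then show ?case by (simp only: walk_path.simps Suc.IH upt_Suc_Suc list.map) simp
qed simp

definition path_eta :: "(int \<times> nat list) list \<Rightarrow> (nat \<times> nat) multiset" where
  "path_eta l = (\<Sum>i<length l. image_mset (Pair (Suc i)) (mset (snd (l ! i))))"

lemma restr_S_eq: "restr_S t S = S 0 # map fst (map (\<lambda>i. (S i, Y i)) [1..<Suc t])"
  by (simp add: restr_S_def upt_conv_Cons comp_def del: upt_Suc)

lemma restr_eta_eq: "restr_eta t Y = path_eta (map (\<lambda>i. (S i, Y i)) [1..<Suc t])"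
  unfolding restr_eta_def path_eta_def
  by (simp add: sum.atLeast1_atMost_eq del: upt_Suc)

lemma events_eq:
  "event_L t S Y \<and> event_ge K t S \<longleftrightarrow>
   int K \<le> S 0 \<and> admissible K (map (\<lambda>i. (S i, Y i)) [1..<Suc t])"
proof -
  have "{0..t} = insert 0 {1..t}" "set [1..<Suc t] = {1..t}" by auto
  then show ?thesis
    unfolding event_L_def event_ge_def admissible_def by (auto simp del: upt_Suc set_upt)
qed

lemma path_end_map:
  "path_end (S 0) (map (\<lambda>i. (S i, Y i)) [1..<Suc t]) = S t"
  by (cases t) (simp_all add: path_end_def)

theorem proposition10:
  fixes w :: local_weight and K p t :: nat and x :: real
    and f :: "int list \<Rightarrow> (nat \<times> nat) multiset \<Rightarrow> ennreal"
  assumes "standing_assumptions w K"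
    and "0 < x" and "ereal x \<le> x_cr w"
  shows "(\<integral>\<^sup>+ T. (if t \<le> ll_time T \<and> event_L t (tree_S T) (tree_Y T) \<and> event_ge K t (tree_S T)
                   then f (restr_S t (tree_S T)) (restr_eta t (tree_Y T)) else 0)
            \<partial>boltzmann w x p)
       = (\<integral>\<^sup>+ \<omega>. (if event_L t (rw_S p \<omega>) (rw_Y \<omega>) \<and> event_ge K t (rw_S p \<omega>)
                   then f (restr_S t (rw_S p \<omega>)) (restr_eta t (rw_Y \<omega>)) *
                        ennreal (W_tilde w x (nat (rw_S p \<omega> t)) / W_tilde w x (nat (rw_S p \<omega> 0)))
                   else 0)
            \<partial>rw_law w K x t)"
    (is "?lhs = ?rhs")
proof -
  note sa = assms(1) and x = assms(2,3)
  define H where "H l = f (int p # map fst l) (path_eta l)" for l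
  have FPT: "(\<Union>n. FPT n p) = {T. fully_parked T \<and> flux T = p}" by (auto simp: FPT_def)
  have "?lhs = (\<integral>\<^sup>+ T. ennreal (x ^ num_vertices T * tree_weight w T) / W w x p *
     (if t \<le> ll_time T \<and> event_L t (tree_S T) (tree_Y T) \<and> event_ge K t (tree_S T)
                   then f (restr_S t (tree_S T)) (restr_eta t (tree_Y T)) else 0)
     \<partial>count_space {T. fully_parked T \<and> flux T = p})"
    unfolding boltzmann_def FPT by (subst nn_integral_density) auto
  also have "\<dots> = (\<integral>\<^sup>+ T. (if K \<le> p then inverse (W w x p) else 0) *
     (if flux T = p then tree_functional w K x t H T else 0) \<partial>count_space UNIV)"
  proof (subst nn_integral_count_space_indicator, simp, intro nn_integral_cong)
    fix T
    have S0: "tree_S T 0 = int (flux T)" by (simp add: tree_S_def ll_vertex_def)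
    show "ennreal (x ^ num_vertices T * tree_weight w T) / W w x p *
     (if t \<le> ll_time T \<and> event_L t (tree_S T) (tree_Y T) \<and> event_ge K t (tree_S T)
                   then f (restr_S t (tree_S T)) (restr_eta t (tree_Y T)) else 0) *
       indicator {T. fully_parked T \<and> flux T = p} T =
      (if K \<le> p then inverse (W w x p) else 0) * (if flux T = p then tree_functional w K x t H T else 0)"
      unfolding events_eq restr_S_eq[of t "tree_S T" "tree_Y T"] restr_eta_eq[of t "tree_Y T" "tree_S T"]
        tree_path_eq_map[symmetric] S0
      by (auto simp: tree_functional_def tree_mass_def H_def divide_ennreal_def mult_ac)
  qed
  also have "\<dots> = (if K \<le> p then inverse (W w x p) else 0) *
      (\<integral>\<^sup>+ T. (if flux T = p then tree_functional w K x t H T else 0) \<partial>count_space UNIV)"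
    by (rule nn_integral_cmult) simp
  finally have lhs: "?lhs = (if K \<le> p then inverse (W w x p) else 0) *
      (\<integral>\<^sup>+ T. (if flux T = p then tree_functional w K x t H T else 0) \<partial>count_space UNIV)" .
  have walk: "walk_path 0 t (int p) \<omega> = map (\<lambda>i. (rw_S p \<omega> i, rw_Y \<omega> i)) [1..<Suc t]" for \<omega>
    by (simp add: walk_path_eq_map rw_S_def del: upt_Suc)
  have S0: "rw_S p \<omega> 0 = int p" for \<omega> by (simp add: rw_S_def)
  have St: "rw_S p \<omega> t = path_end (int p) (walk_path 0 t (int p) \<omega>)" for \<omega>
    using path_end_map[of "rw_S p \<omega>" "rw_Y \<omega>" t] by (simp only: walk S0)
  have rhs: "?rhs = (\<integral>\<^sup>+ \<omega>. (if int K \<le> int p \<and> admissible K (walk_path 0 t (int p) \<omega>)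
     then H (walk_path 0 t (int p) \<omega>) *
       ennreal (W_tilde w x (nat (path_end (int p) (walk_path 0 t (int p) \<omega>))) / W_tilde w x p) else 0)
     \<partial>PiM {1..t} (\<lambda>_. nu_hat_measure w K x))"
    unfolding rw_law_def
  proof (rule nn_integral_cong)
    fix \<omega>
    show "(if event_L t (rw_S p \<omega>) (rw_Y \<omega>) \<and> event_ge K t (rw_S p \<omega>)
       then f (restr_S t (rw_S p \<omega>)) (restr_eta t (rw_Y \<omega>)) *
         ennreal (W_tilde w x (nat (rw_S p \<omega> t)) / W_tilde w x (nat (rw_S p \<omega> 0))) else 0) =
      (if int K \<le> int p \<and> admissible K (walk_path 0 t (int p) \<omega>)
       then H (walk_path 0 t (int p) \<omega>) *
         ennreal (W_tilde w x (nat (path_end (int p) (walk_path 0 t (int p) \<omega>))) / W_tilde w x p) else 0)"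
      unfolding events_eq restr_S_eq[of t "rw_S p \<omega>" "rw_Y \<omega>"] restr_eta_eq[of t "rw_Y \<omega>" "rw_S p \<omega>"]
        walk[symmetric] S0 St H_def nat_int ..
  qed
  show ?thesis
  proof (cases "K \<le> p")
    case False
    then show ?thesis unfolding lhs rhs by simp
  next
    case True
    have Wp: "0 < W w x p" "W w x p < \<infinity>"
      using standing_W_pos[OF sa x(1)] W_finite_ge[OF sa x True] by auto
    have "?rhs = (\<integral>\<^sup>+ \<omega>. inverse (W w x p) * walk_functional w K x (int p) H (walk_path 0 t (int p) \<omega>)
      \<partial>PiM {Suc 0..0 + t} (\<lambda>_. nu_hat_measure w K x))"
      unfolding rhs
    proof (simp only: One_nat_def add_0_left, rule nn_integral_cong)
      fix \<omega>
      let ?l = "walk_path 0 t (int p) \<omega>"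
      have "ennreal (W_tilde w x (nat e) / W_tilde w x p) =
          inverse (W w x p) * (ennreal (y_cr w x powi (e - int p)) * W w x (nat e))" if e: "K \<le> nat e" "0 \<le> e" for e
      proof -
        have We: "0 < W w x (nat e)" "W w x (nat e) < \<infinity>"
          using standing_W_pos[OF sa x(1)] W_finite_ge[OF sa x e(1)] by auto
        have y: "0 < y_cr w x" by (rule y_cr_pos[OF sa x])
        obtain u where u: "W w x p = ennreal u" "0 < u"
          using Wp by (metis ennreal_less_zero_iff infinity_ennreal_def less_top_ennreal)
        obtain v where v: "W w x (nat e) = ennreal v" "0 < v"
          using We by (metis ennreal_less_zero_iff infinity_ennreal_def less_top_ennreal)
        have "y_cr w x powi (e - int p) = y_cr w x ^ nat e / y_cr w x ^ p"
          using y e(2) power_int_diff[of "y_cr w x" e "int p"] by (simp add: power_int_def)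
        then have "W_tilde w x (nat e) / W_tilde w x p = inverse u * (y_cr w x powi (e - int p) * v)"
          using u v y by (simp add: W_tilde_def field_simps)
        then show ?thesis
          using u v y by (simp add: inverse_ennreal ennreal_mult'[symmetric] less_imp_le)
      qed
      moreover have "K \<le> nat (path_end (int p) ?l) \<and> 0 \<le> path_end (int p) ?l" if "admissible K ?l"
      proof -
        have "int K \<le> path_end (int p) ?l"
        proof (cases "?l = []")
          case False
          then have "int K \<le> fst (last ?l)"
            using bspec[OF that[unfolded admissible_def] last_in_set] by (simp add: case_prod_unfold)
          then show ?thesis using False by (simp add: path_end_def)
        qed (use True in simp)
        then show ?thesis by auto
      qed
      ultimately show "(if int K \<le> int p \<and> admissible K ?l
         then H ?l * ennreal (W_tilde w x (nat (path_end (int p) ?l)) / W_tilde w x p) else 0) =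
         inverse (W w x p) * walk_functional w K x (int p) H ?l"
        using True by (simp add: walk_functional_def mult_ac)
    qed
    also have "\<dots> = inverse (W w x p) * (\<integral>\<^sup>+ \<omega>. walk_functional w K x (int p) H (walk_path 0 t (int p) \<omega>)
      \<partial>PiM {Suc 0..0 + t} (\<lambda>_. nu_hat_measure w K x))"
      by (rule nn_integral_cmult) (rule measurable_PiM_nu_hat, simp)
    also have "\<dots> = ?lhs"
      unfolding lhs nn_integral_tree_functional[OF sa x True, of t H 0] using True by simp
    finally show ?thesis ..
  qed
qed

end
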